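(* Let $R$ be a commutative ring with identity, $B$ an $R$-module, $X$ a subset of $B$, and $S$ a commutative $R$-algebra. Let $X'=\{x\otimes s\mid x\in X,\ s\in S\}\subseteq B\otimes_RS$. Then for any $R$-module $M$, $$\operatorname{im}\bigl(\operatorname{tr}^{(R)}_{X,B}(M)\otimes_RS\to M\otimes_RS\bigr)\subseteq\operatorname{tr}^{(S)}_{X',B\otimes_RS}(M\otimes_RS)$$ as $S$-submodules of $M\otimes_RS$. If $B$ is finitely presented and $S$ is flat over $R$, then equality holds.
   Context: For a commutative ring $A$, an $A$-module $L$, a subset $Y\subseteq L$, and an $A$-module $N$, the $(Y,L)$-trace of $N$ over $A$, denoted $\operatorname{tr}^{(A)}_{Y,L}(N)$, is the $A$-submodule of $N$ generated by $\{f(y)\mid f\in\operatorname{Hom}_A(L,N),\ y\in Y\}$. *)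

theory Defs
  imports "HOL.Hull" "HOL-Algebra.Module" "HOL-Algebra.Generated_Groups" "HOL-Algebra.Free_Abelian_Groups"
begin

text \<open>Only the values on the carrier are constrained.\<close>

definition module_hom ::
    "('a, 'x) ring_scheme \<Rightarrow> ('a, 'b, 'y) module_scheme \<Rightarrow> ('a, 'c, 'z) module_scheme \<Rightarrow> ('b \<Rightarrow> 'c) set" where
  "module_hom A L N = {f \<in> carrier L \<rightarrow> carrier N.
     (\<forall>x\<in>carrier L. \<forall>y\<in>carrier L. f (x \<oplus>\<^bsub>L\<^esub> y) = f x \<oplus>\<^bsub>N\<^esub> f y) \<and>
     (\<forall>a\<in>carrier A. \<forall>x\<in>carrier L. f (a \<odot>\<^bsub>L\<^esub> x) = a \<odot>\<^bsub>N\<^esub> f x)}"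

definition submodule_generated ::
    "('a, 'x) ring_scheme \<Rightarrow> ('a, 'b, 'y) module_scheme \<Rightarrow> 'b set \<Rightarrow> 'b set" where
  "submodule_generated A N G = (\<lambda>H. submodule H A N) hull G"

definition trace_submodule ::
    "('a, 'x) ring_scheme \<Rightarrow> 'b set \<Rightarrow> ('a, 'b, 'y) module_scheme \<Rightarrow> ('a, 'c, 'z) module_scheme \<Rightarrow> 'c set" where
  "trace_submodule A Y L N = submodule_generated A N {f y |f y. f \<in> module_hom A L N \<and> y \<in> Y}"


subsection \<open>Finitely presented modules\<close>

definition free_module :: "('a, 'x) ring_scheme \<Rightarrow> nat \<Rightarrow> ('a, nat \<Rightarrow> 'a) module" where
  "free_module A n = \<lparr>carrier = {..<n} \<rightarrow>\<^sub>E carrier A,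
     monoid.mult = undefined, one = undefined,
     ring.zero = (\<lambda>i\<in>{..<n}. \<zero>\<^bsub>A\<^esub>),
     ring.add = (\<lambda>v w. \<lambda>i\<in>{..<n}. v i \<oplus>\<^bsub>A\<^esub> w i),
     smult = (\<lambda>a v. \<lambda>i\<in>{..<n}. a \<otimes>\<^bsub>A\<^esub> v i)\<rparr>"

definition finitely_presented :: "('a, 'x) ring_scheme \<Rightarrow> ('a, 'b, 'y) module_scheme \<Rightarrow> bool" where
  "finitely_presented A L \<longleftrightarrow> (\<exists>n p K.
     p \<in> module_hom A (free_module A n) L \<and> p ` carrier (free_module A n) = carrier L \<and>
     finite K \<and> K \<subseteq> carrier (free_module A n) \<and>
     {v \<in> carrier (free_module A n). p v = \<zero>\<^bsub>L\<^esub>} = submodule_generated A (free_module A n) K)"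


subsection \<open>Base change\<close>

text \<open>
  The tensor product of \<open>M\<close> and \<open>S\<close> over \<open>R\<close> is the free abelian group on the pairs \<open>(m, s)\<close>,
  written additively inside \<^typ>\<open>'a \<Rightarrow>\<^sub>0 int\<close>, modulo the subgroup generated by the elements that
  express biadditivity and \<open>R\<close>-balancedness. Its elements are therefore cosets.
\<close>

abbreviation pair_group ::
    "('r, 'm, 'y) module_scheme \<Rightarrow> ('r, 's, 'z) module_scheme \<Rightarrow> ('m \<times> 's \<Rightarrow>\<^sub>0 int) monoid" where
  "pair_group M S \<equiv> free_Abelian_group (carrier M \<times> carrier S)"

definition tensor_relators ::
    "('r, 'x) ring_scheme \<Rightarrow> ('r, 'm, 'y) module_scheme \<Rightarrow> ('r, 's, 'z) module_scheme \<Rightarrow> ('m \<times> 's \<Rightarrow>\<^sub>0 int) set" where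
  "tensor_relators R M S =
     {frag_of (m \<oplus>\<^bsub>M\<^esub> m', s) - frag_of (m, s) - frag_of (m', s) |m m' s.
        m \<in> carrier M \<and> m' \<in> carrier M \<and> s \<in> carrier S} \<union>
     {frag_of (m, s \<oplus>\<^bsub>S\<^esub> s') - frag_of (m, s) - frag_of (m, s') |m s s'.
        m \<in> carrier M \<and> s \<in> carrier S \<and> s' \<in> carrier S} \<union>
     {frag_of (r \<odot>\<^bsub>M\<^esub> m, s) - frag_of (m, r \<odot>\<^bsub>S\<^esub> s) |r m s.
        r \<in> carrier R \<and> m \<in> carrier M \<and> s \<in> carrier S}"

definition tensor_kernel ::
    "('r, 'x) ring_scheme \<Rightarrow> ('r, 'm, 'y) module_scheme \<Rightarrow> ('r, 's, 'z) module_scheme \<Rightarrow> ('m \<times> 's \<Rightarrow>\<^sub>0 int) set" where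
  "tensor_kernel R M S = generate (pair_group M S) (tensor_relators R M S)"

definition tensor_class ::
    "('r, 'x) ring_scheme \<Rightarrow> ('r, 'm, 'y) module_scheme \<Rightarrow> ('r, 's, 'z) module_scheme \<Rightarrow>
     ('m \<times> 's \<Rightarrow>\<^sub>0 int) \<Rightarrow> ('m \<times> 's \<Rightarrow>\<^sub>0 int) set" where
  "tensor_class R M S c = tensor_kernel R M S #>\<^bsub>pair_group M S\<^esub> c"

definition pure_tensor ::
    "('r, 'x) ring_scheme \<Rightarrow> ('r, 'm, 'y) module_scheme \<Rightarrow> ('r, 's, 'z) module_scheme \<Rightarrow>
     'm \<Rightarrow> 's \<Rightarrow> ('m \<times> 's \<Rightarrow>\<^sub>0 int) set" where
  "pure_tensor R M S m s = tensor_class R M S (frag_of (m, s))"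

text \<open>
  For an \<open>R\<close>-algebra \<open>S\<close>, the \<open>S\<close>-module structure is \<open>a \<cdot> (m \<otimes> s) = m \<otimes> (a s)\<close>. Operations on
  cosets are given as the union of the cosets obtained from all representatives; by
  well-definedness these cosets coincide.
\<close>

definition base_change ::
    "('r, 'x) ring_scheme \<Rightarrow> ('r, 'm, 'y) module_scheme \<Rightarrow> ('r, 's, 'z) module_scheme \<Rightarrow>
     ('s, ('m \<times> 's \<Rightarrow>\<^sub>0 int) set) module" where
  "base_change R M S =
     (let Q = pair_group M S Mod tensor_kernel R M S in
      \<lparr>carrier = carrier Q,
       monoid.mult = undefined, one = undefined,
       ring.zero = one Q,
       ring.add = monoid.mult Q,
       smult = (\<lambda>a C. \<Union>c\<in>C. tensor_class R M S
                  (frag_extend (\<lambda>(m, s). frag_of (m, a \<otimes>\<^bsub>S\<^esub> s)) c))\<rparr>)"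

text \<open>The map \<open>f \<otimes> S\<close>.\<close>

definition base_change_map ::
    "('r, 'x) ring_scheme \<Rightarrow> ('r, 'n, 'y) module_scheme \<Rightarrow> ('r, 's, 'z) module_scheme \<Rightarrow> ('m \<Rightarrow> 'n) \<Rightarrow>
     ('m \<times> 's \<Rightarrow>\<^sub>0 int) set \<Rightarrow> ('n \<times> 's \<Rightarrow>\<^sub>0 int) set" where
  "base_change_map R N S f C =
     (\<Union>c\<in>C. tensor_class R N S (frag_extend (\<lambda>(m, s). frag_of (f m, s)) c))"


subsection \<open>Flatness\<close>

text \<open>
  A formula cannot quantify over all types, so the injective linear maps \<open>f : N \<rightarrow> N'\<close> to be
  preserved are those between modules whose elements have the type \<^typ>\<open>(nat \<Rightarrow> 'r) set\<close>.
  This is no restriction: every finitely (even countably) generated \<open>R\<close>-module is isomorphic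
  to such a module, as a quotient of a submodule of the functions \<open>nat \<Rightarrow> 'r\<close>, and an element
  of \<open>N \<otimes> S\<close> that vanishes in \<open>N' \<otimes> S\<close> already comes from finitely generated submodules
  \<open>N\<^sub>0 \<subseteq> N\<close> and \<open>N'\<^sub>0 \<subseteq> N'\<close> with \<open>f N\<^sub>0 \<subseteq> N'\<^sub>0\<close> such that it vanishes in \<open>N'\<^sub>0 \<otimes> S\<close>.
\<close>

definition flat_algebra :: "('r, 'x) ring_scheme \<Rightarrow> ('r, 's, 'z) module_scheme \<Rightarrow> bool" where
  "flat_algebra R S \<longleftrightarrow>
     (\<forall>(N :: ('r, (nat \<Rightarrow> 'r) set) module) (N' :: ('r, (nat \<Rightarrow> 'r) set) module) f.
        module R N \<and> module R N' \<and> f \<in> module_hom R N N' \<and> inj_on f (carrier N) \<longrightarrow>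
        inj_on (base_change_map R N' S f) (carrier (base_change R N S)))"

end

theory Submission
  imports Defs
begin

text \<open>
  The inclusion follows from \<open>(f \<otimes> S) (x \<otimes> s) = f x \<otimes> s\<close>. For the converse it suffices to write every
  \<open>S\<close>-linear \<open>\<phi> : B \<otimes> S \<rightarrow> M \<otimes> S\<close> as \<open>\<phi> (b \<otimes> s) = \<Sum>\<^sub>t f\<^sub>t b \<otimes> z\<^sub>t\<close> with \<open>f\<^sub>t : B \<rightarrow> M\<close> linear.
  Choose representatives \<open>c\<^sub>i\<close> of the images of finitely many generators of \<open>B\<close>. That the finitely
  many relations of \<open>B\<close> hold between the classes of the \<open>c\<^sub>i\<close> is witnessed by finitely many tensor
  relators, hence by finitely many linear relations between elements of \<open>S\<close>. As \<open>S\<close> is flat, the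
  equational criterion provides scalar functions \<open>a\<^sub>t\<close> that satisfy these relations and elements
  \<open>z\<^sub>t\<close> with \<open>x = \<Sum>\<^sub>t a\<^sub>t x \<cdot> z\<^sub>t\<close> for all \<open>x \<in> S\<close> that occur in the \<open>c\<^sub>i\<close>. The contractions
  \<open>m \<otimes> x \<mapsto> a\<^sub>t x \<cdot> m\<close> map the \<open>c\<^sub>i\<close> to elements of \<open>M\<close> that satisfy the relations of \<open>B\<close>, which
  defines \<open>f\<^sub>t\<close>.
\<close>

abbreviation keys where "keys \<equiv> Poly_Mapping.keys"

section \<open>Subtraction in abelian groups\<close>

lemma (in abelian_group) minus_eq_zeroD:
  assumes "x \<in> carrier G" "y \<in> carrier G" "x \<ominus> y = \<zero>"
  shows "x = y"
  using minus_equality[of x "\<ominus> y"] assms by (simp add: minus_eq)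

lemma (in abelian_group) add_minus_minus:
  "x \<in> carrier G \<Longrightarrow> y \<in> carrier G \<Longrightarrow> x \<oplus> y \<ominus> x \<ominus> y = \<zero>"
  by (simp add: minus_eq a_assoc minus_add[symmetric] r_neg r_neg1 a_comm)

lemma (in abelian_group) finsum_lessThan_Suc:
  assumes "\<And>t. t < Suc q \<Longrightarrow> f t \<in> carrier G"
  shows "(\<Oplus>t\<in>{..<Suc q}. f t) = f q \<oplus> (\<Oplus>t\<in>{..<q}. f t)"
  unfolding lessThan_Suc by (rule finsum_insert) (use assms in auto)

lemma (in abelian_group) diff_closed: "x \<in> carrier G \<Longrightarrow> y \<in> carrier G \<Longrightarrow> x \<ominus> y \<in> carrier G"
  by (simp add: minus_eq)

lemma (in abelian_group) eq_diff_iff: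
  "x \<in> carrier G \<Longrightarrow> y \<in> carrier G \<Longrightarrow> z \<in> carrier G \<Longrightarrow> x = y \<ominus> z \<longleftrightarrow> x \<oplus> z = y"
  by (auto simp: minus_eq a_assoc l_neg r_neg)

section \<open>Linear maps, kernels and factorization through a surjection\<close>

lemma module_homD:
  assumes "f \<in> module_hom A L N"
  shows "x \<in> carrier L \<Longrightarrow> f x \<in> carrier N"
    and "x \<in> carrier L \<Longrightarrow> y \<in> carrier L \<Longrightarrow> f (x \<oplus>\<^bsub>L\<^esub> y) = f x \<oplus>\<^bsub>N\<^esub> f y"
    and "a \<in> carrier A \<Longrightarrow> x \<in> carrier L \<Longrightarrow> f (a \<odot>\<^bsub>L\<^esub> x) = a \<odot>\<^bsub>N\<^esub> f x"
  using assms by (auto simp: module_hom_def)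

lemma module_hom_zero:
  assumes "module A L" "module A N" "f \<in> module_hom A L N"
  shows "f \<zero>\<^bsub>L\<^esub> = \<zero>\<^bsub>N\<^esub>"
proof -
  interpret L: module A L by fact
  interpret N: module A N by fact
  have "f (\<zero>\<^bsub>A\<^esub> \<odot>\<^bsub>L\<^esub> \<zero>\<^bsub>L\<^esub>) = \<zero>\<^bsub>A\<^esub> \<odot>\<^bsub>N\<^esub> f \<zero>\<^bsub>L\<^esub>"
    by (rule module_homD(3)[OF assms(3)]) auto
  with module_homD(1)[OF assms(3)] show ?thesis by simp
qed

lemma module_hom_minus:
  assumes "module A L" "module A N" "f \<in> module_hom A L N" "x \<in> carrier L" "y \<in> carrier L"
  shows "f (x \<ominus>\<^bsub>L\<^esub> y) = f x \<ominus>\<^bsub>N\<^esub> f y"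
proof -
  interpret L: module A L by fact
  interpret N: module A N by fact
  note f = module_homD[OF assms(3)]
  have "f (x \<ominus>\<^bsub>L\<^esub> y) \<oplus>\<^bsub>N\<^esub> f y = f (x \<ominus>\<^bsub>L\<^esub> y \<oplus>\<^bsub>L\<^esub> y)"
    using f(2) assms(4,5) by simp
  also have "x \<ominus>\<^bsub>L\<^esub> y \<oplus>\<^bsub>L\<^esub> y = x"
    using assms(4,5) by (simp add: L.minus_eq L.M.a_assoc L.M.l_neg)
  finally have "f x = f (x \<ominus>\<^bsub>L\<^esub> y) \<oplus>\<^bsub>N\<^esub> f y" by simp
  then show ?thesis
    using f(1) assms(4,5) by (simp add: N.minus_eq N.M.a_assoc N.M.r_neg)
qed

lemma kernel_submodule:
  assumes "module A L" "module A N" "f \<in> module_hom A L N"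
  shows "submodule {v \<in> carrier L. f v = \<zero>\<^bsub>N\<^esub>} A L"
proof -
  interpret L: module A L by fact
  interpret N: module A N by fact
  note fD = module_homD[OF assms(3)] and f0 = module_hom_zero[OF assms]
  show ?thesis
  proof (rule L.submoduleI)
    fix x assume x: "x \<in> {v \<in> carrier L. f v = \<zero>\<^bsub>N\<^esub>}"
    have "\<zero>\<^bsub>L\<^esub> \<ominus>\<^bsub>L\<^esub> x = \<ominus>\<^bsub>L\<^esub> x" using x by (simp add: L.minus_eq)
    then show "\<ominus>\<^bsub>L\<^esub> x \<in> {v \<in> carrier L. f v = \<zero>\<^bsub>N\<^esub>}"
      using module_hom_minus[OF assms L.M.zero_closed, of x] x f0 by (simp add: N.minus_eq)
  qed (auto simp: fD f0)
qed

text \<open>Two preimages of the same element differ by an element that \<open>p\<close> kills,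
  hence \<open>g\<close> kills it too; so \<open>g\<close> after any choice of preimages is linear.
  Serves to descend from a free module to a finitely presented quotient.\<close>

lemma module_hom_factor:
  assumes "module A F" "module A L" "module A N"
    and p: "p \<in> module_hom A F L" and surj: "p ` carrier F = carrier L"
    and g: "g \<in> module_hom A F N"
    and ker: "\<And>v. v \<in> carrier F \<Longrightarrow> p v = \<zero>\<^bsub>L\<^esub> \<Longrightarrow> g v = \<zero>\<^bsub>N\<^esub>"
  obtains f where "f \<in> module_hom A L N" "\<And>v. v \<in> carrier F \<Longrightarrow> f (p v) = g v"
proof -
  interpret F: module A F by fact
  interpret L: module A L by fact
  interpret N: module A N by fact
  note pD = module_homD[OF p] and gD = module_homD[OF g]
  have eq: "g v = g w" if "v \<in> carrier F" "w \<in> carrier F" "p v = p w" for v w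
  proof -
    have "p (v \<ominus>\<^bsub>F\<^esub> w) = \<zero>\<^bsub>L\<^esub>"
      using that pD(1)[of w] by (simp add: module_hom_minus[OF assms(1,2) p] L.minus_eq L.M.r_neg)
    then have "g v \<ominus>\<^bsub>N\<^esub> g w = \<zero>\<^bsub>N\<^esub>"
      using that ker[of "v \<ominus>\<^bsub>F\<^esub> w"] by (simp add: module_hom_minus[OF assms(1,3) g])
    then show ?thesis using that gD(1) N.minus_eq_zeroD[of "g v" "g w"] by simp
  qed
  define f where "f = (\<lambda>x. g (inv_into (carrier F) p x))"
  have fp: "f (p v) = g v" if "v \<in> carrier F" for v
    unfolding f_def by (rule eq) (use that in \<open>auto simp: inv_into_into f_inv_into_f\<close>)
  have "f \<in> module_hom A L N"
    unfolding module_hom_def mem_Collect_eq surj[symmetric]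
  proof (intro conjI ballI funcsetI)
    fix x assume "x \<in> p ` carrier F"
    then obtain v where v: "v \<in> carrier F" "x = p v" by blast
    show "f x \<in> carrier N" using v gD(1) by (simp add: fp)
    show "f (a \<odot>\<^bsub>L\<^esub> x) = a \<odot>\<^bsub>N\<^esub> f x" if "a \<in> carrier A" for a
      using v that fp[of "a \<odot>\<^bsub>F\<^esub> v"] by (simp add: fp gD(3) pD(3))
    fix y assume "y \<in> p ` carrier F"
    then obtain w where w: "w \<in> carrier F" "y = p w" by blast
    show "f (x \<oplus>\<^bsub>L\<^esub> y) = f x \<oplus>\<^bsub>N\<^esub> f y"
      using v w fp[of "v \<oplus>\<^bsub>F\<^esub> w"] by (simp add: fp gD(2) pD(2))
  qed
  with fp show thesis using that by blast
qed

section \<open>Generated submodules, traces and free modules\<close>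

lemma submodule_generated_submodule:
  assumes "module A N" "G \<subseteq> carrier N"
  shows "submodule (submodule_generated A N G) A N"
proof -
  interpret N: module A N by fact
  \<comment> \<open>The intersected family contains the whole module, so the intersection stays
    inside the carrier.\<close>
  have c: "carrier N \<in> {t. submodule t A N \<and> G \<subseteq> t}"
    using N.carrier_is_submodule assms(2) by simp
  show ?thesis unfolding submodule_generated_def hull_def
  proof (rule N.submoduleI)
    show "\<Inter> {t. submodule t A N \<and> G \<subseteq> t} \<subseteq> carrier N" using c by blast
    show "\<zero>\<^bsub>N\<^esub> \<in> \<Inter> {t. submodule t A N \<and> G \<subseteq> t}"
      using subgroup.one_closed[OF submodule.axioms(1)] by fastforce
  next
    fix x y a assume x: "x \<in> \<Inter> {t. submodule t A N \<and> G \<subseteq> t}"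
      and y: "y \<in> \<Inter> {t. submodule t A N \<and> G \<subseteq> t}"
    show "\<ominus>\<^bsub>N\<^esub> x \<in> \<Inter> {t. submodule t A N \<and> G \<subseteq> t}"
      using x N.submoduleE(3) by auto
    show "x \<oplus>\<^bsub>N\<^esub> y \<in> \<Inter> {t. submodule t A N \<and> G \<subseteq> t}"
      using x y N.submoduleE(5) by auto
    show "a \<odot>\<^bsub>N\<^esub> x \<in> \<Inter> {t. submodule t A N \<and> G \<subseteq> t}" if "a \<in> carrier A"
      using that x N.submoduleE(4) by auto
  qed
qed

lemma submodule_generated_incl: "G \<subseteq> submodule_generated A N G"
  by (simp add: submodule_generated_def hull_subset)

lemma submodule_generated_minimal:
  "G \<subseteq> H \<Longrightarrow> submodule H A N \<Longrightarrow> submodule_generated A N G \<subseteq> H"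
  unfolding submodule_generated_def by (rule hull_minimal)

lemma trace_submodule_submodule:
  assumes "module A N" "Y \<subseteq> carrier L"
  shows "submodule (trace_submodule A Y L N) A N"
  unfolding trace_submodule_def
  by (rule submodule_generated_submodule[OF assms(1)]) (use assms(2) module_homD(1) in fastforce)

lemma trace_submodule_mem:
  "f \<in> module_hom A L N \<Longrightarrow> y \<in> Y \<Longrightarrow> f y \<in> trace_submodule A Y L N"
  unfolding trace_submodule_def using submodule_generated_incl by fastforce

lemma module_free_module:
  assumes "cring A"
  shows "module A (free_module A n)"
proof -
  interpret A: cring A by fact
  have "\<exists>y\<in>{..<n} \<rightarrow>\<^sub>E carrier A. (\<lambda>i\<in>{..<n}. y i \<oplus>\<^bsub>A\<^esub> x i) = (\<lambda>i\<in>{..<n}. \<zero>\<^bsub>A\<^esub>)"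
    if "x \<in> {..<n} \<rightarrow>\<^sub>E carrier A" for x
    by (rule bexI[of _ "\<lambda>i\<in>{..<n}. \<ominus>\<^bsub>A\<^esub> x i"])
      (use that in \<open>auto simp: PiE_iff A.l_neg intro!: restrict_ext\<close>)
  then show ?thesis using assms
    by (intro moduleI abelian_groupI)
      (auto simp: free_module_def PiE_iff A.a_ac A.l_distr A.r_distr A.m_assoc
        extensional_def fun_eq_iff)
qed

section \<open>Homomorphisms out of free abelian groups\<close>

text \<open>The additive extension of \<open>g\<close> to the free abelian group on
  \<open>A\<close>. The choice rests on the universal property; arguments with keys outside
  \<open>A\<close> get unspecified values.\<close>

definition frag_lift :: "'k set \<Rightarrow> ('a, 'y) ring_scheme \<Rightarrow> ('k \<Rightarrow> 'a) \<Rightarrow> ('k \<Rightarrow>\<^sub>0 int) \<Rightarrow> 'a" where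
  "frag_lift A N g = (SOME h. h \<in> hom (free_Abelian_group A) (add_monoid N) \<and>
     (\<forall>x\<in>A. h (frag_of x) = g x))"

lemma frag_lift:
  assumes "abelian_group N" "g \<in> A \<rightarrow> carrier N"
  shows frag_lift_of: "x \<in> A \<Longrightarrow> frag_lift A N g (frag_of x) = g x"
    and frag_lift_closed: "keys c \<subseteq> A \<Longrightarrow> frag_lift A N g c \<in> carrier N"
    and frag_lift_add: "keys c \<subseteq> A \<Longrightarrow> keys d \<subseteq> A \<Longrightarrow>
      frag_lift A N g (c + d) = frag_lift A N g c \<oplus>\<^bsub>N\<^esub> frag_lift A N g d"
    and frag_lift_zero: "frag_lift A N g 0 = \<zero>\<^bsub>N\<^esub>"
    and frag_lift_diff: "keys c \<subseteq> A \<Longrightarrow> keys d \<subseteq> A \<Longrightarrow>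
      frag_lift A N g (c - d) = frag_lift A N g c \<ominus>\<^bsub>N\<^esub> frag_lift A N g d"
proof -
  interpret N: abelian_group N by fact
  have "g ` A \<subseteq> carrier (add_monoid N)" using assms(2) by auto
  then have "\<exists>h. h \<in> hom (free_Abelian_group A) (add_monoid N) \<and> (\<forall>x\<in>A. h (frag_of x) = g x)"
    by (rule comm_group.free_Abelian_group_universal[OF N.a_comm_group]) blast
  from someI_ex[OF this] have h: "frag_lift A N g \<in> hom (free_Abelian_group A) (add_monoid N)"
    and of: "\<And>x. x \<in> A \<Longrightarrow> frag_lift A N g (frag_of x) = g x"
    unfolding frag_lift_def by auto
  show "x \<in> A \<Longrightarrow> frag_lift A N g (frag_of x) = g x" by (rule of)
  show cl: "frag_lift A N g c \<in> carrier N" if "keys c \<subseteq> A" for c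
    using hom_in_carrier[OF h, of c] that by simp
  show add: "frag_lift A N g (c + d) = frag_lift A N g c \<oplus>\<^bsub>N\<^esub> frag_lift A N g d"
    if "keys c \<subseteq> A" "keys d \<subseteq> A" for c d
    using hom_mult[OF h, of c d] that by simp
  show "frag_lift A N g 0 = \<zero>\<^bsub>N\<^esub>"
    using add[of 0 0] cl[of 0] by (simp add: N.add.r_cancel_one')
  show "frag_lift A N g (c - d) = frag_lift A N g c \<ominus>\<^bsub>N\<^esub> frag_lift A N g d"
    if "keys c \<subseteq> A" "keys d \<subseteq> A"
  proof -
    have k: "keys (c - d) \<subseteq> A" using that keys_diff by fast
    show ?thesis
      using add[OF k that(2)] cl[OF that(2)] cl[OF k]
      by (simp add: N.minus_eq N.a_assoc N.r_neg)
  qed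
qed

section \<open>Tensor products\<close>

locale tensor =
  fixes R :: "('r, 'x) ring_scheme" and M :: "('r, 'm, 'y) module_scheme"
    and S :: "('r, 's, 'z) module_scheme"
  assumes M_module: "module R M" and S_algebra: "algebra R S"
begin

sublocale M: module R M by (rule M_module)
sublocale S: algebra R S by (rule S_algebra)

abbreviation "K \<equiv> tensor_kernel R M S"
abbreviation "T \<equiv> base_change R M S"
abbreviation "cls \<equiv> tensor_class R M S"
abbreviation "MS \<equiv> carrier M \<times> carrier S"

lemma relators_keys: "c \<in> tensor_relators R M S \<Longrightarrow> keys c \<subseteq> MS"
  unfolding tensor_relators_def by (auto dest!: subsetD[OF keys_diff] simp: keys_frag_of)

lemma relators_subset: "tensor_relators R M S \<subseteq> carrier (pair_group M S)"
  using relators_keys by (intro subsetI) simp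

lemma kernel_zero: "0 \<in> K"
  unfolding tensor_kernel_def using generate.one[of "pair_group M S"] by simp

lemma kernel_add: "c \<in> K \<Longrightarrow> d \<in> K \<Longrightarrow> c + d \<in> K"
  unfolding tensor_kernel_def using generate.eng[of c "pair_group M S" _ d] by simp

lemma kernel_keys: "c \<in> K \<Longrightarrow> keys c \<subseteq> MS"
  using group.generate_in_carrier[OF group_free_Abelian_group relators_subset]
  by (simp add: tensor_kernel_def)

lemma kernel_minus: "c \<in> K \<Longrightarrow> - c \<in> K"
  using group.generate_m_inv_closed[OF group_free_Abelian_group relators_subset, of c] kernel_keys[of c]
  by (simp add: tensor_kernel_def)

lemma kernel_diff: "c \<in> K \<Longrightarrow> d \<in> K \<Longrightarrow> c - d \<in> K"
  using kernel_add[of c "- d"] kernel_minus[of d] by simp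

lemma kernel_sum: "(\<And>i. i \<in> J \<Longrightarrow> f i \<in> K) \<Longrightarrow> sum f J \<in> K"
  by (induction J rule: infinite_finite_induct) (auto intro: kernel_add kernel_zero)

lemma kernel_diff_commute: "c - d \<in> K \<Longrightarrow> d - c \<in> K"
  using kernel_minus by fastforce

lemma kernel_diff_trans: "c - d \<in> K \<Longrightarrow> d - e \<in> K \<Longrightarrow> c - e \<in> K"
  using kernel_add by fastforce

lemma kernel_diff_add: "c - d \<in> K \<Longrightarrow> c' - d' \<in> K \<Longrightarrow> (c + c') - (d + d') \<in> K"
  using kernel_add[of "c - d" "c' - d'"] by (simp add: algebra_simps)

lemma kernel_diff_sum: "(\<And>i. i \<in> J \<Longrightarrow> f i - g i \<in> K) \<Longrightarrow> sum f J - sum g J \<in> K"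
  unfolding sum_subtractf[symmetric] by (rule kernel_sum)

lemma add_left: "m \<in> carrier M \<Longrightarrow> m' \<in> carrier M \<Longrightarrow> s \<in> carrier S \<Longrightarrow>
    frag_of (m \<oplus>\<^bsub>M\<^esub> m', s) - frag_of (m, s) - frag_of (m', s) \<in> K"
  unfolding tensor_kernel_def by (rule generate.incl) (auto simp: tensor_relators_def)

lemma add_right: "m \<in> carrier M \<Longrightarrow> s \<in> carrier S \<Longrightarrow> s' \<in> carrier S \<Longrightarrow>
    frag_of (m, s \<oplus>\<^bsub>S\<^esub> s') - frag_of (m, s) - frag_of (m, s') \<in> K"
  unfolding tensor_kernel_def by (rule generate.incl) (auto simp: tensor_relators_def)

lemma balanced: "r \<in> carrier R \<Longrightarrow> m \<in> carrier M \<Longrightarrow> s \<in> carrier S \<Longrightarrow>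
    frag_of (r \<odot>\<^bsub>M\<^esub> m, s) - frag_of (m, r \<odot>\<^bsub>S\<^esub> s) \<in> K"
  unfolding tensor_kernel_def by (rule generate.incl) (auto simp: tensor_relators_def)

end

lemmas frag_keys_induct = free_Abelian_group_induct [consumes 1, case_names zero diff gen]

lemma keys_diff_subset: "keys c \<subseteq> A \<Longrightarrow> keys d \<subseteq> A \<Longrightarrow> keys (c - d) \<subseteq> A"
  using keys_diff by fast

lemma keys_add_subset: "keys c \<subseteq> A \<Longrightarrow> keys d \<subseteq> A \<Longrightarrow> keys (c + d) \<subseteq> A"
  using keys_add by fast

context tensor
begin

text \<open>Differences replace the sums and inverses of the generated subgroup, as
  \<open>c + d = c - (0 - d)\<close>. The \<open>diff\<close> case provides membership of both
  operands in \<open>K\<close>, because additivity of lifted maps needs their keys in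
  \<open>MS\<close>.\<close>

lemma kernel_induct [consumes 1, case_names zero diff add_left add_right balanced]:
  assumes "c \<in> K" and zero: "P 0"
    and diff: "\<And>c d. c \<in> K \<Longrightarrow> d \<in> K \<Longrightarrow> P c \<Longrightarrow> P d \<Longrightarrow> P (c - d)"
    and "\<And>m m' s. m \<in> carrier M \<Longrightarrow> m' \<in> carrier M \<Longrightarrow> s \<in> carrier S \<Longrightarrow>
      P (frag_of (m \<oplus>\<^bsub>M\<^esub> m', s) - frag_of (m, s) - frag_of (m', s))"
    and "\<And>m s s'. m \<in> carrier M \<Longrightarrow> s \<in> carrier S \<Longrightarrow> s' \<in> carrier S \<Longrightarrow>
      P (frag_of (m, s \<oplus>\<^bsub>S\<^esub> s') - frag_of (m, s) - frag_of (m, s'))"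
    and "\<And>r m s. r \<in> carrier R \<Longrightarrow> m \<in> carrier M \<Longrightarrow> s \<in> carrier S \<Longrightarrow>
      P (frag_of (r \<odot>\<^bsub>M\<^esub> m, s) - frag_of (m, r \<odot>\<^bsub>S\<^esub> s))"
  shows "P c"
proof -
  have rel: "P d" if "d \<in> tensor_relators R M S" for d
    using that assms(4-6) by (auto simp: tensor_relators_def)
  have relK: "d \<in> K" if "d \<in> tensor_relators R M S" for d
    using that unfolding tensor_kernel_def by (rule generate.incl)
  have "c \<in> K \<and> P c"
    using assms(1)[unfolded tensor_kernel_def]
  proof (induction rule: generate.induct)
    case one
    then show ?case using zero kernel_zero by simp
  next
    case (incl h)
    then show ?case using rel relK by blast
  next
    case (inv h)
    have "P (0 - h)" by (rule diff) (use kernel_zero zero rel relK inv in auto)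
    then show ?case using inv relK relators_keys kernel_minus by simp
  next
    case (eng c d)
    have "P (0 - d)" by (rule diff) (use eng kernel_zero zero in auto)
    then have "P (c - (0 - d))" using diff[of c "0 - d"] eng kernel_minus by simp
    then show ?case using eng kernel_add by simp
  qed
  then show ?thesis ..
qed

text \<open>The additivity relator for zero plus zero collapses to minus this element.\<close>

lemma zero_left: "s \<in> carrier S \<Longrightarrow> frag_of (\<zero>\<^bsub>M\<^esub>, s) \<in> K"
  using kernel_minus[OF add_left[of "\<zero>\<^bsub>M\<^esub>" "\<zero>\<^bsub>M\<^esub>" s]] by simp

lemma zero_right: "m \<in> carrier M \<Longrightarrow> frag_of (m, \<zero>\<^bsub>S\<^esub>) \<in> K"
  using kernel_minus[OF add_right[of m "\<zero>\<^bsub>S\<^esub>" "\<zero>\<^bsub>S\<^esub>"]] by simp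

lemma finsum_right:
  assumes "m \<in> carrier M" "finite J" "f \<in> J \<rightarrow> carrier S"
  shows "frag_of (m, \<Oplus>\<^bsub>S\<^esub>j\<in>J. f j) - (\<Sum>j\<in>J. frag_of (m, f j)) \<in> K"
  using assms(2,3)
proof (induction J rule: finite_induct)
  case empty
  then show ?case using zero_right assms(1) by simp
next
  case (insert j J)
  then have *: "f j \<in> carrier S" "f \<in> J \<rightarrow> carrier S" by auto
  from * insert have eq: "(\<Oplus>\<^bsub>S\<^esub>j\<in>insert j J. f j) = f j \<oplus>\<^bsub>S\<^esub> (\<Oplus>\<^bsub>S\<^esub>j\<in>J. f j)"
    by (intro S.finsum_insert) auto
  show ?case unfolding eq
    using kernel_add[OF add_right[OF assms(1) *(1) S.finsum_closed[OF *(2)]] insert.IH[OF *(2)]] insert.hyps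
    by (simp add: algebra_simps)
qed

subsection \<open>The module structure\<close>

text \<open>Rephrases cosets as congruence modulo \<open>K\<close>; from here on, equality of
  tensors is membership of a difference in \<open>K\<close>.\<close>

lemma cls_eq: "cls c = {d. d - c \<in> K}"
proof -
  have "d \<in> K #>\<^bsub>pair_group M S\<^esub> c \<longleftrightarrow> d - c \<in> K" for d
    by (auto simp: r_coset_def intro!: bexI[of _ "d - c"])
  then show ?thesis by (auto simp: tensor_class_def)
qed

lemma cls_nonempty: "cls c \<noteq> {}"
  using kernel_zero by (auto simp: cls_eq intro: exI[of _ c])

lemma cls_eq_iff: "cls c = cls d \<longleftrightarrow> c - d \<in> K"
proof
  assume "cls c = cls d"
  moreover have "c \<in> cls c" using kernel_zero by (simp add: cls_eq)
  ultimately have "c \<in> cls d" by simp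
  then show "c - d \<in> K" by (simp add: cls_eq)
next
  assume "c - d \<in> K"
  then have "e - c \<in> K \<longleftrightarrow> e - d \<in> K" for e
    using kernel_diff_trans[of e c d] kernel_diff_trans[of e d c] kernel_diff_commute[of c d] by blast
  then show "cls c = cls d" by (simp add: cls_eq)
qed

lemma carrier_T: "carrier T = cls ` {c. keys c \<subseteq> MS}"
  by (auto simp: base_change_def Let_def FactGroup_def RCOSETS_def tensor_class_def)

lemma cls_closed: "keys c \<subseteq> MS \<Longrightarrow> cls c \<in> carrier T"
  by (auto simp: carrier_T)

lemma carrier_TE:
  assumes "t \<in> carrier T"
  obtains c where "keys c \<subseteq> MS" "t = cls c"
  using assms by (auto simp: carrier_T)

lemma zero_T: "\<zero>\<^bsub>T\<^esub> = cls 0"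
  by (simp add: base_change_def Let_def FactGroup_def cls_eq)

lemma add_T: "cls c \<oplus>\<^bsub>T\<^esub> cls d = cls (c + d)"
proof -
  have "c' + d' - (c + d) \<in> K" if "c' - c \<in> K" "d' - d \<in> K" for c' d'
    using that by (rule kernel_diff_add)
  \<comment> \<open>The sum of two cosets exhausts the coset of the sum: split \<open>e\<close> as
    \<open>(e - d) + d\<close>.\<close>
  moreover have "\<exists>c' d'. e = c' + d' \<and> c' - c \<in> K \<and> d' - d \<in> K" if "e - (c + d) \<in> K" for e
    using that kernel_zero by (intro exI[of _ "e - d"] exI[of _ d]) (simp add: algebra_simps)
  ultimately have "(e \<in> cls c \<oplus>\<^bsub>T\<^esub> cls d) = (e \<in> cls (c + d))" for e
    unfolding base_change_def Let_def FactGroup_def cls_eq set_mult_def by simp blast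
  then show ?thesis by blast
qed

text \<open>The action on representatives; it descends to classes by
  \<open>scale_kernel\<close>.\<close>

definition scale :: "'s \<Rightarrow> ('m \<times> 's \<Rightarrow>\<^sub>0 int) \<Rightarrow> ('m \<times> 's \<Rightarrow>\<^sub>0 int)" where
  "scale a = frag_extend (\<lambda>(m, s). frag_of (m, a \<otimes>\<^bsub>S\<^esub> s))"

lemma scale_simps [simp]:
  "scale a 0 = 0" "scale a (c + d) = scale a c + scale a d" "scale a (c - d) = scale a c - scale a d"
  "scale a (frag_of (m, s)) = frag_of (m, a \<otimes>\<^bsub>S\<^esub> s)"
  by (simp_all add: scale_def frag_extend_add frag_extend_diff)

lemma scale_keys: "a \<in> carrier S \<Longrightarrow> keys c \<subseteq> MS \<Longrightarrow> keys (scale a c) \<subseteq> MS"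
  unfolding scale_def by (rule order_trans[OF keys_frag_extend]) (auto simp: keys_frag_of)

lemma smult_assoc_right:
  assumes "r \<in> carrier R" "a \<in> carrier S" "s \<in> carrier S"
  shows "a \<otimes>\<^bsub>S\<^esub> (r \<odot>\<^bsub>S\<^esub> s) = r \<odot>\<^bsub>S\<^esub> (a \<otimes>\<^bsub>S\<^esub> s)"
  using assms S.smult_assoc2[of r s a] by (simp add: S.m_comm)

text \<open>Each relator is sent to a relator of the same shape; in the balanced case this uses that
  multiplication in \<open>S\<close> is \<open>R\<close>-linear.\<close>

lemma scale_kernel:
  assumes a: "a \<in> carrier S" and "c \<in> K"
  shows "scale a c \<in> K"
  using assms(2)
proof (induction rule: kernel_induct)
  case (add_right m s s')
  then show ?case using tensor.add_right[OF tensor_axioms, of m "a \<otimes>\<^bsub>S\<^esub> s" "a \<otimes>\<^bsub>S\<^esub> s'"] a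
    by (simp add: S.r_distr)
next
  case (balanced r m s)
  then show ?case using tensor.balanced[OF tensor_axioms, of r m "a \<otimes>\<^bsub>S\<^esub> s"] a
    by (simp add: smult_assoc_right)
qed (use a kernel_zero in \<open>auto intro: kernel_diff tensor.add_left[OF tensor_axioms]\<close>)

lemma smult_T: 
  assumes "a \<in> carrier S"
  shows "a \<odot>\<^bsub>T\<^esub> cls c = cls (scale a c)"
proof -
  have "a \<odot>\<^bsub>T\<^esub> cls c = (\<Union>d\<in>cls c. cls (scale a d))"
    by (simp add: base_change_def Let_def scale_def)
  \<comment> \<open>Congruent representatives have congruent multiples, so the union in
    \<open>base_change\<close> runs over a single coset.\<close>
  also have "cls (scale a d) = cls (scale a c)" if "d \<in> cls c" for d
    using that scale_kernel[OF assms, of "d - c"] by (simp add: cls_eq_iff cls_eq[of c])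
  then have "(\<Union>d\<in>cls c. cls (scale a d)) = (\<Union>d\<in>cls c. cls (scale a c))" by simp
  also have "\<dots> = cls (scale a c)"
    using cls_nonempty by auto
  finally show ?thesis .
qed

lemma module_T: "module S T"
proof (rule moduleI)
  show "cring S" by (rule S.M_cring)
  show "abelian_group T"
  proof (rule abelian_groupI)
    fix x assume "x \<in> carrier T"
    then obtain c where "keys c \<subseteq> MS" "x = cls c" by (rule carrier_TE)
    then show "\<exists>y\<in>carrier T. y \<oplus>\<^bsub>T\<^esub> x = \<zero>\<^bsub>T\<^esub>"
      by (intro bexI[of _ "cls (- c)"]) (auto simp: add_T zero_T cls_closed)
  qed (auto elim!: carrier_TE simp: add_T zero_T cls_closed keys_add_subset add.commute add.left_commute)
  fix a b x assume ab: "a \<in> carrier S" "b \<in> carrier S" and "x \<in> carrier T"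
  then obtain c where c: "keys c \<subseteq> MS" "x = cls c" by (auto elim: carrier_TE)
  show "a \<odot>\<^bsub>T\<^esub> x \<in> carrier T" using c ab by (simp add: smult_T cls_closed scale_keys)
  \<comment> \<open>This module axiom holds for representatives only modulo \<open>K\<close>, by
    additivity in \<open>S\<close>; the other identities hold for the representatives
    themselves.\<close>
  have "scale (a \<oplus>\<^bsub>S\<^esub> b) c - (scale a c + scale b c) \<in> K"
    using c(1)
  proof (induction rule: frag_keys_induct)
    case (diff c d)
    then show ?case using kernel_diff[OF diff(3,4)] by (simp add: algebra_simps)
  next
    case (gen ms)
    then show ?case using add_right[of "fst ms" "a \<otimes>\<^bsub>S\<^esub> snd ms" "b \<otimes>\<^bsub>S\<^esub> snd ms"] ab
      by (cases ms) (auto simp: S.l_distr algebra_simps)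
  qed (simp add: kernel_zero)
  then show "(a \<oplus>\<^bsub>S\<^esub> b) \<odot>\<^bsub>T\<^esub> x = a \<odot>\<^bsub>T\<^esub> x \<oplus>\<^bsub>T\<^esub> b \<odot>\<^bsub>T\<^esub> x"
    using ab c by (simp add: smult_T add_T cls_eq_iff)
  have "scale (a \<otimes>\<^bsub>S\<^esub> b) c = scale a (scale b c)"
    using c(1) by (induction rule: frag_keys_induct) (auto simp: S.m_assoc ab)
  then show "(a \<otimes>\<^bsub>S\<^esub> b) \<odot>\<^bsub>T\<^esub> x = a \<odot>\<^bsub>T\<^esub> (b \<odot>\<^bsub>T\<^esub> x)"
    using ab c by (simp add: smult_T)
  fix y assume "y \<in> carrier T"
  then obtain d where d: "keys d \<subseteq> MS" "y = cls d" by (auto elim: carrier_TE)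
  show "a \<odot>\<^bsub>T\<^esub> (x \<oplus>\<^bsub>T\<^esub> y) = a \<odot>\<^bsub>T\<^esub> x \<oplus>\<^bsub>T\<^esub> a \<odot>\<^bsub>T\<^esub> y"
    using ab c d by (simp add: smult_T add_T)
next
  fix x assume "x \<in> carrier T"
  then obtain c where c: "keys c \<subseteq> MS" "x = cls c" by (auto elim: carrier_TE)
  have "scale \<one>\<^bsub>S\<^esub> c = c"
    using c(1) by (induction rule: frag_keys_induct) auto
  then show "\<one>\<^bsub>S\<^esub> \<odot>\<^bsub>T\<^esub> x = x" using c by (simp add: smult_T)
qed

sublocale T: module S T by (rule module_T)

lemma minus_T: "keys c \<subseteq> MS \<Longrightarrow> \<ominus>\<^bsub>T\<^esub> cls c = cls (- c)"
  by (rule T.M.minus_equality) (auto simp: add_T zero_T cls_closed)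

end

subsection \<open>Functoriality\<close>

text \<open>Linearity of \<open>f\<close> carries relators to relators of the same kind, so the
  induced map is well defined on classes.\<close>

lemma (in tensor) base_change_map_kernel:
  assumes "module R N" and f: "f \<in> module_hom R M N" and "c \<in> K"
  shows "frag_extend (\<lambda>(m, s). frag_of (f m, s)) c \<in> tensor_kernel R N S"
proof -
  interpret N: tensor R N S using assms(1) S_algebra by (rule tensor.intro)
  note fD = module_homD[OF f]
  show ?thesis using assms(3)
    by (induction rule: kernel_induct)
      (auto simp: frag_extend_diff fD N.kernel_zero N.kernel_diff N.add_left N.add_right N.balanced)
qed

lemma (in tensor) base_change_map_cls:
  assumes "module R N" and f: "f \<in> module_hom R M N"
  shows "base_change_map R N S f (cls c) =
    tensor_class R N S (frag_extend (\<lambda>(m, s). frag_of (f m, s)) c)"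
proof -
  interpret N: tensor R N S using assms(1) S_algebra by (rule tensor.intro)
  let ?E = "frag_extend (\<lambda>(m, s). frag_of (f m, s))"
  have "N.cls (?E d) = N.cls (?E c)" if "d \<in> cls c" for d
    using that base_change_map_kernel[OF assms, of "d - c"]
    by (simp add: N.cls_eq_iff cls_eq[of c] frag_extend_diff)
  then have "base_change_map R N S f (cls c) = (\<Union>d\<in>cls c. N.cls (?E c))"
    by (simp add: base_change_map_def)
  then show ?thesis using cls_nonempty by auto
qed

lemma (in tensor) base_change_map_hom:
  assumes "module R N" and f: "f \<in> module_hom R M N"
  shows "base_change_map R N S f \<in> module_hom S T (base_change R N S)"
proof -
  interpret N: tensor R N S using assms(1) S_algebra by (rule tensor.intro)
  let ?E = "frag_extend (\<lambda>(m, s). frag_of (f m, s))"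
  have E_keys: "keys (?E c) \<subseteq> N.MS" if "keys c \<subseteq> MS" for c
    by (rule order_trans[OF keys_frag_extend])
      (use that module_homD(1)[OF f] in \<open>auto simp: keys_frag_of\<close>)
  have "?E (scale a c) = N.scale a (?E c)" if "keys c \<subseteq> MS" for a c
    using that by (induction rule: frag_keys_induct) (auto simp: frag_extend_diff)
  then show ?thesis
    unfolding module_hom_def
    by (auto elim!: carrier_TE simp: base_change_map_cls[OF assms] E_keys N.cls_closed
      add_T N.add_T smult_T N.smult_T frag_extend_add)
qed

text \<open>The induced map does not change representatives, it only enlarges the kernel modulo
  which they are read; so the image is described without reference to the tensor product of
  \<open>H\<close>.\<close>

lemma (in tensor) base_change_map_inclusion_image:
  assumes "submodule H R M"
  shows "base_change_map R M S (\<lambda>t. t) ` carrier (base_change R (M\<lparr>carrier := H\<rparr>) S) =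
    cls ` {c. keys c \<subseteq> H \<times> carrier S}"
proof -
  interpret H: tensor R "M\<lparr>carrier := H\<rparr>" S
    using submodule.submodule_is_module[OF assms M_module] S_algebra by (rule tensor.intro)
  have hom: "(\<lambda>t. t) \<in> module_hom R (M\<lparr>carrier := H\<rparr>) M"
    using M.submoduleE(1)[OF assms] by (auto simp: module_hom_def)
  have "frag_extend (\<lambda>(m, s). frag_of (m, s)) c = c" for c :: "'m \<times> 's \<Rightarrow>\<^sub>0 int"
    using frag_expansion[of c] by (simp add: case_prod_unfold)
  then show ?thesis
    by (simp add: H.carrier_T image_image H.base_change_map_cls[OF M_module hom])
qed

lemma (in tensor) submodule_cls_image:
  assumes "submodule H R M"
  shows "submodule (cls ` {c. keys c \<subseteq> H \<times> carrier S}) S T"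
proof -
  have H: "H \<times> carrier S \<subseteq> MS" using M.submoduleE(1)[OF assms] by auto
  have scale_H: "keys (scale a c) \<subseteq> H \<times> carrier S" if "a \<in> carrier S" "keys c \<subseteq> H \<times> carrier S" for a c
    unfolding scale_def
    by (rule order_trans[OF keys_frag_extend]) (use that in \<open>auto simp: keys_frag_of\<close>)
  have mono: "keys c \<subseteq> MS" if "keys c \<subseteq> H \<times> carrier S" for c
    using that H by (rule order_trans)
  show ?thesis
  proof (rule T.submoduleI)
    show "cls ` {c. keys c \<subseteq> H \<times> carrier S} \<subseteq> carrier T"
      using mono by (auto intro: cls_closed)
    show "\<zero>\<^bsub>T\<^esub> \<in> cls ` {c. keys c \<subseteq> H \<times> carrier S}" by (auto simp: zero_T)
  qed (auto simp: minus_T mono add_T smult_T keys_add_subset scale_H)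
qed

section \<open>The equational criterion for flatness\<close>

text \<open>
  The sequences over \<open>R\<close> are wrapped into singletons because \<^const>\<open>flat_algebra\<close> only concerns
  modules whose elements have type \<^typ>\<open>(nat \<Rightarrow> 'r) set\<close>.
\<close>

definition seq_module :: "('r, 'x) ring_scheme \<Rightarrow> ('r, (nat \<Rightarrow> 'r) set) module" where
  "seq_module R = \<lparr>carrier = (\<lambda>v. {v}) ` (UNIV \<rightarrow> carrier R),
     monoid.mult = undefined, one = undefined,
     ring.zero = {\<lambda>_. \<zero>\<^bsub>R\<^esub>},
     ring.add = (\<lambda>C D. {\<lambda>j. the_elem C j \<oplus>\<^bsub>R\<^esub> the_elem D j}),
     smult = (\<lambda>a C. {\<lambda>j. a \<otimes>\<^bsub>R\<^esub> the_elem C j})\<rparr>"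

lemma seq_module_simps [simp]:
  "{v} \<in> carrier (seq_module R) \<longleftrightarrow> (\<forall>j. v j \<in> carrier R)"
  "\<zero>\<^bsub>seq_module R\<^esub> = {\<lambda>_. \<zero>\<^bsub>R\<^esub>}"
  "{v} \<oplus>\<^bsub>seq_module R\<^esub> {w} = {\<lambda>j. v j \<oplus>\<^bsub>R\<^esub> w j}"
  "a \<odot>\<^bsub>seq_module R\<^esub> {v} = {\<lambda>j. a \<otimes>\<^bsub>R\<^esub> v j}"
  by (auto simp: seq_module_def)

lemma seq_moduleE:
  assumes "C \<in> carrier (seq_module R)"
  obtains v where "C = {v}" "\<And>j. v j \<in> carrier R"
  using assms by (auto simp: seq_module_def)

lemma module_seq_module:
  assumes "cring R"
  shows "module R (seq_module R)"
proof -
  interpret R: cring R by fact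
  have "\<exists>y\<in>carrier (seq_module R). y \<oplus>\<^bsub>seq_module R\<^esub> {v} = {\<lambda>_. \<zero>\<^bsub>R\<^esub>}"
    if "\<And>j. v j \<in> carrier R" for v
    by (rule bexI[of _ "{\<lambda>j. \<ominus>\<^bsub>R\<^esub> v j}"]) (use that in \<open>auto simp: R.l_neg\<close>)
  then show ?thesis
    by (intro moduleI abelian_groupI assms)
      (auto elim!: seq_moduleE simp: R.a_ac R.l_distr R.r_distr R.m_assoc)
qed

text \<open>
  For \<open>j < m\<close> the element \<open>\<rho> j \<odot> \<sigma> j \<oplus> \<tau> j\<close> of \<open>S\<close> counts as an unknown of its own; a solution
  assigns scalars to all elements of \<open>S\<close> such that these \<open>m\<close> linear relations persist. The case
  \<open>\<rho> j = \<one>\<close> expresses additivity.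
\<close>

locale relations = S: algebra R S
  for R :: "('r, 'x) ring_scheme" and S :: "('r, 's, 'z) module_scheme" +
  fixes m :: nat and \<rho> :: "nat \<Rightarrow> 'r" and \<sigma> \<tau> :: "nat \<Rightarrow> 's" and G :: "'s set"
  assumes rel_closed: "\<And>j. j < m \<Longrightarrow> \<rho> j \<in> carrier R" "\<And>j. j < m \<Longrightarrow> \<sigma> j \<in> G" "\<And>j. j < m \<Longrightarrow> \<tau> j \<in> G"
      "\<And>j. j < m \<Longrightarrow> \<rho> j \<odot>\<^bsub>S\<^esub> \<sigma> j \<oplus>\<^bsub>S\<^esub> \<tau> j \<in> G"
    and G_finite: "finite G" and G_subset: "G \<subseteq> carrier S"
begin

section \<open>The defect of a scalar function\<close>

abbreviation "V \<equiv> carrier S \<rightarrow> carrier R"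

text \<open>The failure of \<open>a\<close> to satisfy relation \<open>j\<close>. Padding with zeros
  from \<open>m\<close> on makes it an infinite sequence, so that its singleton lies in
  \<open>seq_module\<close>.\<close>

definition defect :: "('s \<Rightarrow> 'r) \<Rightarrow> nat \<Rightarrow> 'r" where
  "defect a j = (if j < m
     then a (\<rho> j \<odot>\<^bsub>S\<^esub> \<sigma> j \<oplus>\<^bsub>S\<^esub> \<tau> j) \<ominus>\<^bsub>R\<^esub> (\<rho> j \<otimes>\<^bsub>R\<^esub> a (\<sigma> j) \<oplus>\<^bsub>R\<^esub> a (\<tau> j)) else \<zero>\<^bsub>R\<^esub>)"

lemma sig_closed: "j < m \<Longrightarrow> \<sigma> j \<in> carrier S" "j < m \<Longrightarrow> \<tau> j \<in> carrier S"
  using rel_closed G_subset by auto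

lemma defect_closed: "a \<in> V \<Longrightarrow> defect a j \<in> carrier R"
  using sig_closed rel_closed(1) by (auto simp: defect_def Pi_iff S.R.minus_eq)

text \<open>Sums (\<open>r\<close> equal to one) and multiples (\<open>b\<close> equal to zero) are
  both special cases, so the ring computation is done once.\<close>

lemma defect_linear:
  assumes "a \<in> V" "b \<in> V" "r \<in> carrier R"
  shows "defect (\<lambda>x. r \<otimes>\<^bsub>R\<^esub> a x \<oplus>\<^bsub>R\<^esub> b x) j = r \<otimes>\<^bsub>R\<^esub> defect a j \<oplus>\<^bsub>R\<^esub> defect b j"
proof (cases "j < m")
  case True
  have id: "r \<otimes>\<^bsub>R\<^esub> x \<oplus>\<^bsub>R\<^esub> x' \<ominus>\<^bsub>R\<^esub> (p \<otimes>\<^bsub>R\<^esub> (r \<otimes>\<^bsub>R\<^esub> y \<oplus>\<^bsub>R\<^esub> y') \<oplus>\<^bsub>R\<^esub> (r \<otimes>\<^bsub>R\<^esub> z \<oplus>\<^bsub>R\<^esub> z'))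
      = r \<otimes>\<^bsub>R\<^esub> (x \<ominus>\<^bsub>R\<^esub> (p \<otimes>\<^bsub>R\<^esub> y \<oplus>\<^bsub>R\<^esub> z)) \<oplus>\<^bsub>R\<^esub> (x' \<ominus>\<^bsub>R\<^esub> (p \<otimes>\<^bsub>R\<^esub> y' \<oplus>\<^bsub>R\<^esub> z'))"
    if "x \<in> carrier R" "x' \<in> carrier R" "y \<in> carrier R" "y' \<in> carrier R" "z \<in> carrier R"
      "z' \<in> carrier R" "p \<in> carrier R" for x x' y y' z z' p
    using that assms(3) by algebra
  show ?thesis
    using True assms sig_closed[OF True] rel_closed(1)[OF True] by (simp add: defect_def id Pi_iff)
qed (use assms in \<open>simp add: defect_def\<close>)

lemma defect_add:
  assumes "a \<in> V" "b \<in> V"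
  shows "defect (\<lambda>x. a x \<oplus>\<^bsub>R\<^esub> b x) j = defect a j \<oplus>\<^bsub>R\<^esub> defect b j"
proof -
  \<comment> \<open>The two functions may differ off the carrier of \<open>S\<close>, where
    \<open>a\<close> is unconstrained; \<open>defect\<close> does not see this.\<close>
  have "defect (\<lambda>x. \<one>\<^bsub>R\<^esub> \<otimes>\<^bsub>R\<^esub> a x \<oplus>\<^bsub>R\<^esub> b x) j = defect (\<lambda>x. a x \<oplus>\<^bsub>R\<^esub> b x) j"
    using assms sig_closed[of j] rel_closed(1)[of j] by (simp add: defect_def Pi_iff)
  then show ?thesis using defect_linear[OF assms S.R.one_closed, of j] defect_closed[OF assms(1)] by simp
qed

lemma defect_zero: "defect (\<lambda>x. \<zero>\<^bsub>R\<^esub>) j = \<zero>\<^bsub>R\<^esub>"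
  using rel_closed(1)[of j] by (simp add: defect_def S.R.minus_eq)

lemma defect_smult:
  assumes "a \<in> V" "r \<in> carrier R"
  shows "defect (\<lambda>x. r \<otimes>\<^bsub>R\<^esub> a x) j = r \<otimes>\<^bsub>R\<^esub> defect a j"
proof -
  have "defect (\<lambda>x. r \<otimes>\<^bsub>R\<^esub> a x \<oplus>\<^bsub>R\<^esub> \<zero>\<^bsub>R\<^esub>) j = defect (\<lambda>x. r \<otimes>\<^bsub>R\<^esub> a x) j"
    using assms sig_closed[of j] rel_closed(1)[of j] by (simp add: defect_def Pi_iff)
  then show ?thesis
    using defect_linear[OF assms(1) _ assms(2), of "\<lambda>x. \<zero>\<^bsub>R\<^esub>" j] defect_closed[OF assms(1)] assms(2)
    by (simp add: defect_zero)
qed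

lemma defect_diff:
  assumes "a \<in> V" "b \<in> V"
  shows "defect (\<lambda>x. a x \<ominus>\<^bsub>R\<^esub> b x) j = defect a j \<ominus>\<^bsub>R\<^esub> defect b j"
proof -
  have ab: "(\<lambda>x. a x \<ominus>\<^bsub>R\<^esub> b x) \<in> V" using assms by auto
  have "defect (\<lambda>x. a x \<ominus>\<^bsub>R\<^esub> b x \<oplus>\<^bsub>R\<^esub> b x) j = defect a j"
    using assms sig_closed[of j] rel_closed(1)[of j]
    by (simp add: defect_def Pi_iff S.R.minus_eq S.R.a_assoc S.R.l_neg)
  then show ?thesis
    using defect_add[OF ab assms(2), of j] defect_closed[OF ab] defect_closed[OF assms(1)] defect_closed[OF assms(2)]
    by (simp add: S.R.eq_diff_iff)
qed

section \<open>Solutions and their span over \<open>S\<close>\<close>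

definition solution :: "('s \<Rightarrow> 'r) \<Rightarrow> bool" where
  "solution a \<longleftrightarrow> a \<in> V \<and> (\<forall>j. defect a j = \<zero>\<^bsub>R\<^esub>)"

lemma solutionD:
  assumes "solution a" "j < m"
  shows "a (\<rho> j \<odot>\<^bsub>S\<^esub> \<sigma> j \<oplus>\<^bsub>S\<^esub> \<tau> j) = \<rho> j \<otimes>\<^bsub>R\<^esub> a (\<sigma> j) \<oplus>\<^bsub>R\<^esub> a (\<tau> j)"
proof (rule S.R.minus_eq_zeroD)
  show "a (\<rho> j \<odot>\<^bsub>S\<^esub> \<sigma> j \<oplus>\<^bsub>S\<^esub> \<tau> j) \<ominus>\<^bsub>R\<^esub> (\<rho> j \<otimes>\<^bsub>R\<^esub> a (\<sigma> j) \<oplus>\<^bsub>R\<^esub> a (\<tau> j)) = \<zero>\<^bsub>R\<^esub>"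
    using assms unfolding solution_def defect_def by metis
qed (use assms sig_closed[of j] rel_closed(1)[of j] in \<open>auto simp: solution_def Pi_iff\<close>)

text \<open>The \<open>S\<close>-submodule that the solutions generate in the functions from
  \<open>G\<close> to \<open>S\<close>. The rules speak of values on \<open>G\<close> only, so
  functions are identified when they agree there.\<close>

inductive solution_span :: "('s \<Rightarrow> 's) \<Rightarrow> bool" where
  solution_span_zero: "\<forall>g\<in>G. w g = \<zero>\<^bsub>S\<^esub> \<Longrightarrow> solution_span w"
| solution_span_step: "solution_span w \<Longrightarrow> solution a \<Longrightarrow> s \<in> carrier S \<Longrightarrow>
    \<forall>g\<in>G. w' g = a g \<odot>\<^bsub>S\<^esub> s \<oplus>\<^bsub>S\<^esub> w g \<Longrightarrow> solution_span w'"

lemma solution_closed: "solution a \<Longrightarrow> g \<in> G \<Longrightarrow> a g \<in> carrier R"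
  using G_subset by (auto simp: solution_def)

lemma solution_span_closed: "solution_span w \<Longrightarrow> g \<in> G \<Longrightarrow> w g \<in> carrier S"
  by (induction rule: solution_span.induct) (auto simp: solution_closed)

lemma solution_span_cong: "solution_span w \<Longrightarrow> \<forall>g\<in>G. u g = w g \<Longrightarrow> solution_span u"
  by (induction arbitrary: u rule: solution_span.induct) (auto intro: solution_span.intros)

lemma solution_span_single:
  assumes "solution a" "s \<in> carrier S" "\<forall>g\<in>G. w g = a g \<odot>\<^bsub>S\<^esub> s"
  shows "solution_span w"
  using solution_span_zero[of "\<lambda>_. \<zero>\<^bsub>S\<^esub>"] assms
  by (auto intro!: solution_span_step[of "\<lambda>_. \<zero>\<^bsub>S\<^esub>" a s] simp: solution_closed)

text \<open>Induction on the subtrahend: taking off a summand \<open>a g \<odot> s\<close> is adding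
  the summand with coefficient \<open>\<ominus> s\<close>, again a generating step.\<close>

lemma solution_span_diff:
  assumes "solution_span v" "solution_span w" "\<forall>g\<in>G. u g = w g \<ominus>\<^bsub>S\<^esub> v g"
  shows "solution_span u"
  using assms(1,3)
proof (induction arbitrary: u rule: solution_span.induct)
  case (solution_span_zero v)
  then show ?case
    using solution_span_closed[OF assms(2)] by (intro solution_span_cong[OF assms(2)]) (auto simp: S.M.minus_eq)
next
  case (solution_span_step v a s v')
  have a: "solution a" "s \<in> carrier S" by fact+
  show ?case
  proof (rule solution_span.solution_span_step)
    show "solution_span (\<lambda>g. w g \<ominus>\<^bsub>S\<^esub> v g)" by (rule solution_span_step.IH) simp
    show "solution a" "\<ominus>\<^bsub>S\<^esub> s \<in> carrier S" using a by auto
    have id: "w \<ominus>\<^bsub>S\<^esub> (x \<oplus>\<^bsub>S\<^esub> v) = \<ominus>\<^bsub>S\<^esub> x \<oplus>\<^bsub>S\<^esub> (w \<ominus>\<^bsub>S\<^esub> v)"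
      if "w \<in> carrier S" "x \<in> carrier S" "v \<in> carrier S" for w x v
      using that by (simp add: S.M.minus_eq S.M.minus_add S.M.a_ac)
    show "\<forall>g\<in>G. u g = a g \<odot>\<^bsub>S\<^esub> (\<ominus>\<^bsub>S\<^esub> s) \<oplus>\<^bsub>S\<^esub> (w g \<ominus>\<^bsub>S\<^esub> v g)"
      using solution_span_step.prems solution_span_step.hyps(4) a solution_span_closed[OF assms(2)] solution_span_closed[OF solution_span_step.hyps(1)]
      by (simp add: S.smult_r_minus solution_closed id)
  qed
qed

lemma solution_span_finsum:
  assumes "solution_span w"
  shows "\<exists>(q::nat) a s. (\<forall>t<q. solution (a t) \<and> s t \<in> carrier S) \<and>
    (\<forall>g\<in>G. w g = (\<Oplus>\<^bsub>S\<^esub>t\<in>{..<q}. a t g \<odot>\<^bsub>S\<^esub> s t))"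
  using assms
proof induction
  case (solution_span_zero w)
  then show ?case by (intro exI[of _ "0::nat"]) simp
next
  case (solution_span_step w a s w')
  then obtain q :: nat and b z where IH: "\<forall>t<q. solution (b t) \<and> z t \<in> carrier S"
      "\<forall>g\<in>G. w g = (\<Oplus>\<^bsub>S\<^esub>t\<in>{..<q}. b t g \<odot>\<^bsub>S\<^esub> z t)" by blast
  \<comment> \<open>The new summand goes to index \<open>q\<close>, which leaves the earlier ones
    untouched.\<close>
  let ?b = "b(q := a)" and ?z = "z(q := s)"
  have "w' g = (\<Oplus>\<^bsub>S\<^esub>t\<in>{..<Suc q}. ?b t g \<odot>\<^bsub>S\<^esub> ?z t)" if g: "g \<in> G" for g
  proof -
    have "(\<Oplus>\<^bsub>S\<^esub>t\<in>{..<Suc q}. ?b t g \<odot>\<^bsub>S\<^esub> ?z t) =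
        ?b q g \<odot>\<^bsub>S\<^esub> ?z q \<oplus>\<^bsub>S\<^esub> (\<Oplus>\<^bsub>S\<^esub>t\<in>{..<q}. ?b t g \<odot>\<^bsub>S\<^esub> ?z t)"
      by (rule S.M.finsum_lessThan_Suc) (use IH(1) solution_span_step.hyps g in \<open>auto simp: less_Suc_eq solution_closed\<close>)
    also have "(\<Oplus>\<^bsub>S\<^esub>t\<in>{..<q}. ?b t g \<odot>\<^bsub>S\<^esub> ?z t) = (\<Oplus>\<^bsub>S\<^esub>t\<in>{..<q}. b t g \<odot>\<^bsub>S\<^esub> z t)"
      by (rule S.M.finsum_cong') (use IH(1) g in \<open>auto simp: solution_closed\<close>)
    finally show ?thesis using IH(2) solution_span_step.hyps(4) g by simp
  qed
  moreover have "\<forall>t<Suc q. solution (?b t) \<and> ?z t \<in> carrier S"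
    using IH(1) solution_span_step.hyps by (simp add: less_Suc_eq)
  ultimately show ?case by blast
qed

end

section \<open>The tensor that encodes the relations\<close>

text \<open>A sequence supported below \<open>m\<close> is a combination of unit sequences;
  balancing moves its entries to the second factor.\<close>

lemma frag_of_seq_expansion:
  assumes "algebra R S" "\<And>j. v j \<in> carrier R" "\<And>j. j \<ge> m \<Longrightarrow> v j = \<zero>\<^bsub>R\<^esub>" "s \<in> carrier S"
  shows "frag_of ({v}, s) - (\<Sum>j<m. frag_of ({\<lambda>i. if i = j then \<one>\<^bsub>R\<^esub> else \<zero>\<^bsub>R\<^esub>}, v j \<odot>\<^bsub>S\<^esub> s))
    \<in> tensor_kernel R (seq_module R) S"
  using assms(2,3)
proof (induction m arbitrary: v)
  interpret S: algebra R S by fact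
  interpret N: tensor R "seq_module R" S
    using module_seq_module[OF S.R_cring] assms(1) by (rule tensor.intro)
  case 0
  then have "v = (\<lambda>_. \<zero>\<^bsub>R\<^esub>)" by auto
  then show ?case using N.zero_left[OF assms(4)] by simp
next
  interpret S: algebra R S by fact
  interpret N: tensor R "seq_module R" S
    using module_seq_module[OF S.R_cring] assms(1) by (rule tensor.intro)
  let ?e = "\<lambda>j i. if i = (j::nat) then \<one>\<^bsub>R\<^esub> else \<zero>\<^bsub>R\<^esub>"
  case (Suc m)
  \<comment> \<open>Erasing entry \<open>m\<close> gives a sequence supported below
    \<open>m\<close>, to which the induction hypothesis applies.\<close>
  define v' where "v' = v(m := \<zero>\<^bsub>R\<^esub>)"
  have "{v} = {v'} \<oplus>\<^bsub>seq_module R\<^esub> (v m \<odot>\<^bsub>seq_module R\<^esub> {?e m})"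
    using Suc.prems(1) by (auto simp: v'_def fun_eq_iff)
  then have 1: "frag_of ({v}, s) - frag_of ({v'}, s) - frag_of (v m \<odot>\<^bsub>seq_module R\<^esub> {?e m}, s) \<in> N.K"
    using N.add_left[of "{v'}" "v m \<odot>\<^bsub>seq_module R\<^esub> {?e m}" s] Suc.prems(1) assms(4) by (auto simp: v'_def)
  have 2: "frag_of (v m \<odot>\<^bsub>seq_module R\<^esub> {?e m}, s) - frag_of ({?e m}, v m \<odot>\<^bsub>S\<^esub> s) \<in> N.K"
    using Suc.prems(1) assms(4) by (intro N.balanced) auto
  have "frag_of ({v'}, s) - (\<Sum>j<m. frag_of ({?e j}, v' j \<odot>\<^bsub>S\<^esub> s)) \<in> N.K"
    by (rule Suc.IH) (use Suc.prems le_neq_implies_less in \<open>auto simp: v'_def Suc_le_eq\<close>)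
  also have "(\<Sum>j<m. frag_of ({?e j}, v' j \<odot>\<^bsub>S\<^esub> s)) = (\<Sum>j<m. frag_of ({?e j}, v j \<odot>\<^bsub>S\<^esub> s))"
    by (rule sum.cong) (auto simp: v'_def)
  finally show ?case
    using N.kernel_add[OF N.kernel_add[OF 1 2]] by (fastforce simp: algebra_simps)
qed

context relations
begin

abbreviation "delta g \<equiv> (\<lambda>x. if x = g then \<one>\<^bsub>R\<^esub> else \<zero>\<^bsub>R\<^esub>)"

text \<open>The tensor of the defects of the coordinate functions with the elements of
  \<open>G\<close>: coordinate \<open>j\<close> collects the coefficients of relation
  \<open>j\<close>, so that the \<open>m\<close> relations in \<open>S\<close> become the vanishing
  of one tensor.\<close>

definition "defect_frag = (\<Sum>g\<in>G. frag_of ({defect (delta g)}, g))"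

text \<open>The image of \<open>defect\<close>, a submodule of the sequences; flatness will be
  applied to its inclusion.\<close>

abbreviation "defects \<equiv> (\<lambda>a. {defect a}) ` V"

lemma delta_closed: "delta g \<in> V" by auto

lemma finsum_delta:
  assumes "y \<in> G"
  shows "(\<Oplus>\<^bsub>S\<^esub>g\<in>G. delta g y \<odot>\<^bsub>S\<^esub> g) = y"
proof -
  have "(\<Oplus>\<^bsub>S\<^esub>g\<in>G. delta g y \<odot>\<^bsub>S\<^esub> g) = (\<Oplus>\<^bsub>S\<^esub>g\<in>G. if y = g then g else \<zero>\<^bsub>S\<^esub>)"
    by (rule S.M.finsum_cong') (use G_subset in auto)
  also have "\<dots> = y"
    by (rule S.M.finsum_singleton) (use assms G_finite G_subset in auto)
  finally show ?thesis .
qed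

text \<open>By linearity of the defect, the sum is the defect of the identity function, which
  satisfies every relation because its unknowns are the actual elements of \<open>S\<close>.\<close>

lemma finsum_defect_delta:
  assumes j: "j < m"
  shows "(\<Oplus>\<^bsub>S\<^esub>g\<in>G. defect (delta g) j \<odot>\<^bsub>S\<^esub> g) = \<zero>\<^bsub>S\<^esub>"
proof -
  let ?y = "\<rho> j \<odot>\<^bsub>S\<^esub> \<sigma> j \<oplus>\<^bsub>S\<^esub> \<tau> j"
  note c = sig_closed[OF j] rel_closed[OF j]
  have dG: "(\<lambda>g. defect (delta g) j \<odot>\<^bsub>S\<^esub> g) \<in> G \<rightarrow> carrier S"
    using G_subset by (auto intro!: S.smult_closed defect_closed)
  have d: "(\<lambda>g. delta g x \<odot>\<^bsub>S\<^esub> g) \<in> G \<rightarrow> carrier S" for x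
    using G_subset by auto
  \<comment> \<open>The equation is proved after adding \<open>?y\<close>: the defect plus the right
    side of relation \<open>j\<close> is its left side, whose sum is \<open>?y\<close> again, and
    \<open>?y\<close> is cancelled at the end.\<close>
  have "(\<Oplus>\<^bsub>S\<^esub>g\<in>G. defect (delta g) j \<odot>\<^bsub>S\<^esub> g) \<oplus>\<^bsub>S\<^esub> ?y =
      (\<Oplus>\<^bsub>S\<^esub>g\<in>G. defect (delta g) j \<odot>\<^bsub>S\<^esub> g) \<oplus>\<^bsub>S\<^esub>
        (\<rho> j \<odot>\<^bsub>S\<^esub> (\<Oplus>\<^bsub>S\<^esub>g\<in>G. delta g (\<sigma> j) \<odot>\<^bsub>S\<^esub> g) \<oplus>\<^bsub>S\<^esub> (\<Oplus>\<^bsub>S\<^esub>g\<in>G. delta g (\<tau> j) \<odot>\<^bsub>S\<^esub> g))"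
    using c(4,5) by (simp only: finsum_delta)
  also have "\<dots> = (\<Oplus>\<^bsub>S\<^esub>g\<in>G. defect (delta g) j \<odot>\<^bsub>S\<^esub> g \<oplus>\<^bsub>S\<^esub>
      (\<rho> j \<odot>\<^bsub>S\<^esub> (delta g (\<sigma> j) \<odot>\<^bsub>S\<^esub> g) \<oplus>\<^bsub>S\<^esub> delta g (\<tau> j) \<odot>\<^bsub>S\<^esub> g))"
  proof -
    have d': "(\<lambda>g. \<rho> j \<odot>\<^bsub>S\<^esub> (delta g (\<sigma> j) \<odot>\<^bsub>S\<^esub> g)) \<in> G \<rightarrow> carrier S"
      using d c(3) by (auto simp: Pi_iff)
    have d'': "(\<lambda>g. \<rho> j \<odot>\<^bsub>S\<^esub> (delta g (\<sigma> j) \<odot>\<^bsub>S\<^esub> g) \<oplus>\<^bsub>S\<^esub> delta g (\<tau> j) \<odot>\<^bsub>S\<^esub> g) \<in> G \<rightarrow> carrier S"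
      using d d' by (auto simp: Pi_iff)
    show ?thesis
      unfolding S.finsum_smult_ldistr[OF G_finite c(3) d] S.M.finsum_addf[OF dG d'']
        S.M.finsum_addf[OF d' d] by (rule refl)
  qed
  also have "\<dots> = (\<Oplus>\<^bsub>S\<^esub>g\<in>G. delta g ?y \<odot>\<^bsub>S\<^esub> g)"
  proof (rule S.M.finsum_cong'[OF refl d])
    fix g assume "g \<in> G"
    then have g: "g \<in> carrier S" using G_subset by auto
    have "defect (delta g) j \<oplus>\<^bsub>R\<^esub> (\<rho> j \<otimes>\<^bsub>R\<^esub> delta g (\<sigma> j) \<oplus>\<^bsub>R\<^esub> delta g (\<tau> j)) = delta g ?y"
      using c(3) j S.R.eq_diff_iff[of "defect (delta g) j" "delta g ?y"
          "\<rho> j \<otimes>\<^bsub>R\<^esub> delta g (\<sigma> j) \<oplus>\<^bsub>R\<^esub> delta g (\<tau> j)"] defect_closed[OF delta_closed]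
      by (simp add: defect_def del: if_split)
    then have "delta g ?y \<odot>\<^bsub>S\<^esub> g =
        (defect (delta g) j \<oplus>\<^bsub>R\<^esub> (\<rho> j \<otimes>\<^bsub>R\<^esub> delta g (\<sigma> j) \<oplus>\<^bsub>R\<^esub> delta g (\<tau> j))) \<odot>\<^bsub>S\<^esub> g"
      by simp
    also have "\<dots> = defect (delta g) j \<odot>\<^bsub>S\<^esub> g \<oplus>\<^bsub>S\<^esub>
      (\<rho> j \<odot>\<^bsub>S\<^esub> (delta g (\<sigma> j) \<odot>\<^bsub>S\<^esub> g) \<oplus>\<^bsub>S\<^esub> delta g (\<tau> j) \<odot>\<^bsub>S\<^esub> g)"
    proof -
      have "delta g x \<in> carrier R" for x by simp
      then show ?thesis
        using g c(3) defect_closed[OF delta_closed, of g j]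
        by (simp only: S.smult_l_distr S.smult_assoc1 S.R.add.m_closed S.R.m_closed)
    qed
    finally show "defect (delta g) j \<odot>\<^bsub>S\<^esub> g \<oplus>\<^bsub>S\<^esub>
      (\<rho> j \<odot>\<^bsub>S\<^esub> (delta g (\<sigma> j) \<odot>\<^bsub>S\<^esub> g) \<oplus>\<^bsub>S\<^esub> delta g (\<tau> j) \<odot>\<^bsub>S\<^esub> g) = delta g ?y \<odot>\<^bsub>S\<^esub> g" ..
  qed
  also have "\<dots> = ?y" using c(6) by (rule finsum_delta)
  finally show ?thesis
    using S.M.finsum_closed[OF dG] c by (simp add: S.M.add.r_cancel_one')
qed

text \<open>Expanding in unit sequences and exchanging the sums leaves, for each \<open>j\<close>, a
  unit sequence tensored with the sum of \<open>finsum_defect_delta\<close>, which is zero.\<close>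

lemma defect_frag_kernel: "defect_frag \<in> tensor_kernel R (seq_module R) S"
proof -
  interpret N: tensor R "seq_module R" S
    using module_seq_module[OF S.R_cring] S.algebra_axioms by (rule tensor.intro)
  let ?e = "\<lambda>j. {\<lambda>i. if i = (j::nat) then \<one>\<^bsub>R\<^esub> else \<zero>\<^bsub>R\<^esub>}"
  have "defect_frag - (\<Sum>g\<in>G. \<Sum>j<m. frag_of (?e j, defect (delta g) j \<odot>\<^bsub>S\<^esub> g)) \<in> N.K"
    unfolding defect_frag_def
  proof (rule N.kernel_diff_sum)
    fix g assume "g \<in> G"
    then have "g \<in> carrier S" using G_subset by auto
    then show "frag_of ({defect (delta g)}, g) - (\<Sum>j<m. frag_of (?e j, defect (delta g) j \<odot>\<^bsub>S\<^esub> g)) \<in> N.K"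
      by (intro frag_of_seq_expansion S.algebra_axioms defect_closed delta_closed) (auto simp: defect_def)
  qed
  moreover have "(\<Sum>g\<in>G. frag_of (?e j, defect (delta g) j \<odot>\<^bsub>S\<^esub> g)) \<in> N.K" if j: "j < m" for j
  proof -
    have "frag_of (?e j, \<Oplus>\<^bsub>S\<^esub>g\<in>G. defect (delta g) j \<odot>\<^bsub>S\<^esub> g) -
        (\<Sum>g\<in>G. frag_of (?e j, defect (delta g) j \<odot>\<^bsub>S\<^esub> g)) \<in> N.K"
      using G_finite G_subset by (intro N.finsum_right) (auto intro!: S.smult_closed defect_closed)
    from N.kernel_diff[OF N.zero_right[of "?e j"] this] show ?thesis
      by (simp add: finsum_defect_delta[OF j])
  qed
  ultimately show ?thesis
    using N.kernel_add[OF _ N.kernel_sum[of "{..<m}" "\<lambda>j. \<Sum>g\<in>G. frag_of (?e j, defect (delta g) j \<odot>\<^bsub>S\<^esub> g)"]]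
    by (subst (asm) sum.swap) fastforce
qed

lemma submodule_defects: "submodule defects R (seq_module R)"
proof -
  interpret N: module R "seq_module R" using module_seq_module[OF S.R_cring] .
  show ?thesis
  proof (rule N.submoduleI)
    show "defects \<subseteq> carrier (seq_module R)" by (auto simp: defect_closed)
    have "{\<lambda>_. \<zero>\<^bsub>R\<^esub>} = {defect (\<lambda>_. \<zero>\<^bsub>R\<^esub>)}" by (simp add: defect_zero fun_eq_iff)
    then show "\<zero>\<^bsub>seq_module R\<^esub> \<in> defects" by (auto intro!: image_eqI)
  next
    fix C assume "C \<in> defects"
    then obtain a where a: "a \<in> V" "C = {defect a}" by auto
    have smult: "r \<odot>\<^bsub>seq_module R\<^esub> C \<in> defects" if "r \<in> carrier R" for r
      using a that
      by (intro image_eqI[of _ _ "\<lambda>x. r \<otimes>\<^bsub>R\<^esub> a x"]) (auto simp: defect_smult fun_eq_iff)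
    then show "r \<odot>\<^bsub>seq_module R\<^esub> C \<in> defects" if "r \<in> carrier R" for r using that .
    have "C \<in> carrier (seq_module R)" using a by (simp add: defect_closed)
    then have "\<ominus>\<^bsub>seq_module R\<^esub> C = (\<ominus>\<^bsub>R\<^esub> \<one>\<^bsub>R\<^esub>) \<odot>\<^bsub>seq_module R\<^esub> C"
      by (simp add: N.smult_l_minus)
    then show "\<ominus>\<^bsub>seq_module R\<^esub> C \<in> defects" using smult by simp
    fix D assume "D \<in> defects"
    then obtain b where b: "b \<in> V" "D = {defect b}" by auto
    show "C \<oplus>\<^bsub>seq_module R\<^esub> D \<in> defects"
      using a b
      by (intro image_eqI[of _ _ "\<lambda>x. a x \<oplus>\<^bsub>R\<^esub> b x"]) (auto simp: defect_add fun_eq_iff)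
  qed
qed

text \<open>Here flatness enters: the inclusion of \<open>defects\<close> into all sequences stays
  injective after base change, so a tensor that vanishes in the larger module vanishes already over
  \<open>defects\<close>.\<close>

lemma flat_defect_frag_kernel:
  assumes "flat_algebra R S"
  shows "defect_frag \<in> tensor_kernel R (seq_module R\<lparr>carrier := defects\<rparr>) S"
proof -
  let ?N = "seq_module R\<lparr>carrier := defects\<rparr>"
  have N': "module R (seq_module R)" using module_seq_module[OF S.R_cring] .
  have N: "module R ?N" using submodule.submodule_is_module[OF submodule_defects N'] .
  interpret N: tensor R ?N S using N S.algebra_axioms by (rule tensor.intro)
  interpret N': tensor R "seq_module R" S using N' S.algebra_axioms by (rule tensor.intro)
  have hom: "(\<lambda>t. t) \<in> module_hom R ?N (seq_module R)"
    using N'.M.submoduleE(1)[OF submodule_defects] by (auto simp: module_hom_def)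
  then have inj: "inj_on (base_change_map R (seq_module R) S (\<lambda>t. t)) (carrier N.T)"
    using assms[unfolded flat_algebra_def, rule_format, of ?N "seq_module R" "\<lambda>t. t"] N N' by simp
  \<comment> \<open>On representatives the inclusion acts as the identity.\<close>
  have id: "frag_extend (\<lambda>(m, s). frag_of (m, s)) c = c" for c :: "(nat \<Rightarrow> 'r) set \<times> 's \<Rightarrow>\<^sub>0 int"
    using frag_expansion[of c] by (simp add: case_prod_unfold)
  have keys: "keys defect_frag \<subseteq> N.MS"
    unfolding defect_frag_def using G_subset
    by (intro order_trans[OF keys_sum]) (auto simp: keys_frag_of)
  have "N.cls defect_frag = N.cls 0"
  proof (rule inj_onD[OF inj])
    show "base_change_map R (seq_module R) S (\<lambda>t. t) (N.cls defect_frag) =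
        base_change_map R (seq_module R) S (\<lambda>t. t) (N.cls 0)"
      using defect_frag_kernel by (simp add: N.base_change_map_cls[OF N' hom] id N'.cls_eq_iff)
    show "N.cls defect_frag \<in> carrier N.T" using keys by (rule N.cls_closed)
    show "N.cls 0 \<in> carrier N.T" by (rule N.cls_closed) simp
  qed
  then show ?thesis by (simp add: N.cls_eq_iff)
qed

lemma solution_diff:
  assumes "a \<in> V" "b \<in> V" "\<And>j. defect a j = defect b j"
  shows "solution (\<lambda>x. a x \<ominus>\<^bsub>R\<^esub> b x)"
proof -
  have "(\<lambda>x. a x \<ominus>\<^bsub>R\<^esub> b x) \<in> V" using assms(1,2) by auto
  moreover have "defect b j \<ominus>\<^bsub>R\<^esub> defect b j = \<zero>\<^bsub>R\<^esub>" for j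
    using defect_closed[OF assms(2)] by (simp add: S.R.minus_eq S.R.r_neg)
  ultimately show ?thesis
    unfolding solution_def defect_diff[OF assms(1,2)] assms(3) by blast
qed

text \<open>
  A section of \<^const>\<open>defect\<close> induces a well-defined map from the tensor product of \<open>defects\<close> with
  \<open>S\<close> to the functions on \<open>G\<close> modulo the span of the solutions. It sends \<^const>\<open>defect_frag\<close>, which
  vanishes in the tensor product, to the class of the identity.
\<close>

lemma flat_id_solution_span:
  assumes "flat_algebra R S"
  shows "solution_span (\<lambda>g. g)"
proof -
  let ?N = "seq_module R\<lparr>carrier := defects\<rparr>"
  have N': "module R (seq_module R)" using module_seq_module[OF S.R_cring] .
  have N: "module R ?N" using submodule.submodule_is_module[OF submodule_defects N'] .
  interpret N: tensor R ?N S using N S.algebra_axioms by (rule tensor.intro)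
  \<comment> \<open>An arbitrary choice of preimages under \<open>defect\<close>; it need not be
    linear, but its deviations from linearity have defect zero, that is, they are solutions.\<close>
  define sec where "sec n = (SOME a. a \<in> V \<and> {defect a} = n)" for n
  have sec: "sec n \<in> V" "{defect (sec n)} = n" if "n \<in> defects" for n
    using someI_ex[of "\<lambda>a. a \<in> V \<and> {defect a} = n"] that unfolding sec_def by auto
  have sec_closed: "sec n x \<in> carrier R" if "n \<in> defects" "x \<in> G" for n x
    using sec(1)[OF that(1)] that(2) G_subset by auto
  \<comment> \<open>The value at \<open>g\<close> of the map that sends \<open>n\<close> tensor
    \<open>s\<close> to the function \<open>sec n\<close> times \<open>s\<close>, on
    representatives.\<close>
  define \<Phi> where "\<Phi> g = frag_lift N.MS S (\<lambda>(n, s). sec n g \<odot>\<^bsub>S\<^esub> s)" for g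
  have pi: "(\<lambda>(n, s). sec n g \<odot>\<^bsub>S\<^esub> s) \<in> N.MS \<rightarrow> carrier S" if "g \<in> G" for g
    using sec_closed that by auto
  note ab = S.M.abelian_group_axioms
  have \<Phi>_of: "\<Phi> g (frag_of (n, s)) = sec n g \<odot>\<^bsub>S\<^esub> s" if "g \<in> G" "n \<in> defects" "s \<in> carrier S" for g n s
    unfolding \<Phi>_def using frag_lift_of[OF ab pi[OF that(1)], of "(n, s)"] that by simp
  have \<Phi>_diff: "\<Phi> g (c - d) = \<Phi> g c \<ominus>\<^bsub>S\<^esub> \<Phi> g d" if "g \<in> G" "keys c \<subseteq> N.MS" "keys d \<subseteq> N.MS" for g c d
    unfolding \<Phi>_def using that by (intro frag_lift_diff ab pi)
  have \<Phi>_add: "\<Phi> g (c + d) = \<Phi> g c \<oplus>\<^bsub>S\<^esub> \<Phi> g d" if "g \<in> G" "keys c \<subseteq> N.MS" "keys d \<subseteq> N.MS" for g c d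
    unfolding \<Phi>_def using that by (intro frag_lift_add ab pi)
  have \<Phi>_zero: "\<Phi> g 0 = \<zero>\<^bsub>S\<^esub>" if "g \<in> G" for g
    unfolding \<Phi>_def using that by (intro frag_lift_zero ab pi)
  have \<Phi>_closed: "\<Phi> g c \<in> carrier S" if "g \<in> G" "keys c \<subseteq> N.MS" for g c
    unfolding \<Phi>_def using that by (intro frag_lift_closed ab pi)
  have keys3: "keys (frag_of x - frag_of y - frag_of z) \<subseteq> {x, y, z}" for x y z :: "(nat \<Rightarrow> 'r) set \<times> 's"
    by (intro keys_diff_subset) (auto simp: keys_frag_of)
  \<comment> \<open>Well-definedness modulo the span: every relator goes to zero or to a deviation
    of \<open>sec\<close> from linearity, times an element of \<open>S\<close>.\<close>
  have span_\<Phi>: "solution_span (\<lambda>g. \<Phi> g c)" if "c \<in> N.K" for c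
    using that
  proof (induction rule: N.kernel_induct)
    case zero
    then show ?case by (intro solution_span_zero) (simp add: \<Phi>_zero)
  next
    case (diff c d)
    then show ?case
      by (intro solution_span_diff[OF diff(4,3)] ballI \<Phi>_diff N.kernel_keys)
  next
    case (add_left n n' s)
    then have n: "n \<in> defects" "n' \<in> defects" "n \<oplus>\<^bsub>seq_module R\<^esub> n' \<in> defects" and s: "s \<in> carrier S"
      using N.M.a_closed[of n n'] by auto
    let ?a = "\<lambda>x. sec (n \<oplus>\<^bsub>seq_module R\<^esub> n') x \<ominus>\<^bsub>R\<^esub> sec n x \<ominus>\<^bsub>R\<^esub> sec n' x"
    have "defect (sec (n \<oplus>\<^bsub>seq_module R\<^esub> n')) j = defect (sec n) j \<oplus>\<^bsub>R\<^esub> defect (sec n') j" for j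
    proof -
      have "{defect (sec (n \<oplus>\<^bsub>seq_module R\<^esub> n'))} =
          {defect (sec n)} \<oplus>\<^bsub>seq_module R\<^esub> {defect (sec n')}"
        unfolding sec(2)[OF n(1)] sec(2)[OF n(2)] by (rule sec(2)[OF n(3)])
      then show ?thesis by simp
    qed
    moreover have "(\<lambda>x. sec (n \<oplus>\<^bsub>seq_module R\<^esub> n') x \<ominus>\<^bsub>R\<^esub> sec n x) \<in> V"
      using sec(1)[OF n(1)] sec(1)[OF n(3)] by auto
    ultimately have "solution ?a"
      using sec(1)[OF n(1)] sec(1)[OF n(2)] sec(1)[OF n(3)]
      by (auto simp: solution_def defect_diff defect_closed S.R.add_minus_minus)
    moreover have "\<Phi> g (frag_of (n \<oplus>\<^bsub>seq_module R\<^esub> n', s) - frag_of (n, s) - frag_of (n', s)) = ?a g \<odot>\<^bsub>S\<^esub> s"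
      if g: "g \<in> G" for g
      using n s sec_closed[OF _ g]
      by (simp add: \<Phi>_diff[OF g] \<Phi>_of[OF g] keys_diff_subset keys_frag_of S.R.minus_eq S.M.minus_eq
          S.smult_l_distr S.smult_l_minus)
    ultimately show ?case using s by (intro solution_span_single[of ?a s]) auto
  next
    case (add_right n s s')
    then have n: "n \<in> defects" by simp
    have "\<Phi> g (frag_of (n, s \<oplus>\<^bsub>S\<^esub> s') - frag_of (n, s) - frag_of (n, s')) = \<zero>\<^bsub>S\<^esub>" if g: "g \<in> G" for g
      using n add_right(2,3) sec_closed[OF n g]
      by (simp add: \<Phi>_diff[OF g] \<Phi>_of[OF g] keys_diff_subset keys_frag_of S.smult_r_distr
          S.M.add_minus_minus)
    then show ?case by (intro solution_span_zero) simp
  next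
    case (balanced r n s)
    then have n: "n \<in> defects" "r \<odot>\<^bsub>seq_module R\<^esub> n \<in> defects"
      using N.M.smult_closed[of r n] by auto
    let ?a = "\<lambda>x. sec (r \<odot>\<^bsub>seq_module R\<^esub> n) x \<ominus>\<^bsub>R\<^esub> r \<otimes>\<^bsub>R\<^esub> sec n x"
    have "defect (sec (r \<odot>\<^bsub>seq_module R\<^esub> n)) j = r \<otimes>\<^bsub>R\<^esub> defect (sec n) j" for j
    proof -
      have "{defect (sec (r \<odot>\<^bsub>seq_module R\<^esub> n))} = r \<odot>\<^bsub>seq_module R\<^esub> {defect (sec n)}"
        unfolding sec(2)[OF n(1)] by (rule sec(2)[OF n(2)])
      then show ?thesis by simp
    qed
    then have "solution ?a"
      using sec(1)[OF n(1)] sec(1)[OF n(2)] balanced(1)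
      by (intro solution_diff) (auto simp: defect_smult)
    moreover have "\<Phi> g (frag_of (r \<odot>\<^bsub>seq_module R\<^esub> n, s) - frag_of (n, r \<odot>\<^bsub>S\<^esub> s)) = ?a g \<odot>\<^bsub>S\<^esub> s"
      if g: "g \<in> G" for g
    proof -
      have "sec n g \<odot>\<^bsub>S\<^esub> (r \<odot>\<^bsub>S\<^esub> s) = (r \<otimes>\<^bsub>R\<^esub> sec n g) \<odot>\<^bsub>S\<^esub> s"
        using balanced sec_closed[OF n(1) g]
        by (subst S.R.m_comm) (auto simp: S.smult_assoc1)
      then show ?thesis
        using n balanced sec_closed[OF _ g]
        by (simp add: \<Phi>_diff[OF g] \<Phi>_of[OF g] keys_diff_subset keys_frag_of S.R.minus_eq S.M.minus_eq
            S.smult_l_distr S.smult_l_minus)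
    qed
    ultimately show ?case using balanced by (intro solution_span_single[of ?a s]) auto
  qed
  have def_delta: "{defect (delta g)} \<in> defects" for g using delta_closed by auto
  \<comment> \<open>The function that \<open>sec\<close> chooses for the defect of
    \<open>delta g\<close> differs from \<open>delta g\<close> by a solution. The sum is built up
    one element of \<open>G\<close> at a time, hence the subset \<open>F\<close>.\<close>
  have "solution_span (\<lambda>h. \<Phi> h (\<Sum>g\<in>F. frag_of ({defect (delta g)}, g)) \<ominus>\<^bsub>S\<^esub> (\<Oplus>\<^bsub>S\<^esub>g\<in>F. delta g h \<odot>\<^bsub>S\<^esub> g))"
    if "F \<subseteq> G" for F
    using finite_subset[OF that G_finite] that
  proof (induction F rule: finite_induct)
    case empty
    then show ?case by (intro solution_span_zero) (simp add: \<Phi>_zero S.M.minus_eq)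
  next
    case (insert x F)
    then have x: "x \<in> G" "x \<in> carrier S" and F: "F \<subseteq> G" "F \<subseteq> carrier S" using G_subset by auto
    let ?n = "{defect (delta x)}" and ?c = "\<Sum>g\<in>F. frag_of ({defect (delta g)}, g)"
    let ?a = "\<lambda>h. sec ?n h \<ominus>\<^bsub>R\<^esub> delta x h"
    have kc: "keys ?c \<subseteq> N.MS"
      using F by (intro order_trans[OF keys_sum]) (auto simp: keys_frag_of)
    show ?case
    proof (rule solution_span_step[OF insert.IH[OF F(1)] _ x(2)])
      have "defect (sec ?n) = defect (delta x)" using sec(2)[OF def_delta, of x] by simp
      then show "solution ?a"
        using sec(1)[OF def_delta] delta_closed by (intro solution_diff) auto
      show "\<forall>h\<in>G. \<Phi> h (\<Sum>g\<in>insert x F. frag_of ({defect (delta g)}, g)) \<ominus>\<^bsub>S\<^esub> (\<Oplus>\<^bsub>S\<^esub>g\<in>insert x F. delta g h \<odot>\<^bsub>S\<^esub> g)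
        = ?a h \<odot>\<^bsub>S\<^esub> x \<oplus>\<^bsub>S\<^esub> (\<Phi> h ?c \<ominus>\<^bsub>S\<^esub> (\<Oplus>\<^bsub>S\<^esub>g\<in>F. delta g h \<odot>\<^bsub>S\<^esub> g))"
      proof
        fix h assume h: "h \<in> G"
        have del: "delta g h \<in> carrier R" for g by simp
        have 1: "\<Phi> h (\<Sum>g\<in>insert x F. frag_of ({defect (delta g)}, g)) = sec ?n h \<odot>\<^bsub>S\<^esub> x \<oplus>\<^bsub>S\<^esub> \<Phi> h ?c"
          using insert.hyps x kc def_delta[of x]
          by (simp add: \<Phi>_add[OF h] \<Phi>_of[OF h] keys_frag_of)
        have 2: "(\<Oplus>\<^bsub>S\<^esub>g\<in>insert x F. delta g h \<odot>\<^bsub>S\<^esub> g) = delta x h \<odot>\<^bsub>S\<^esub> x \<oplus>\<^bsub>S\<^esub> (\<Oplus>\<^bsub>S\<^esub>g\<in>F. delta g h \<odot>\<^bsub>S\<^esub> g)"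
          by (rule S.M.finsum_insert) (use insert.hyps x F in auto)
        have 3: "?a h \<odot>\<^bsub>S\<^esub> x = sec ?n h \<odot>\<^bsub>S\<^esub> x \<ominus>\<^bsub>S\<^esub> delta x h \<odot>\<^bsub>S\<^esub> x"
          unfolding S.R.minus_eq S.M.minus_eq
          using sec_closed[OF def_delta h] x del[of x]
          by (simp only: S.smult_l_distr S.smult_l_minus S.R.a_inv_closed)
        have id: "a \<oplus>\<^bsub>S\<^esub> b \<ominus>\<^bsub>S\<^esub> (c \<oplus>\<^bsub>S\<^esub> d) = a \<ominus>\<^bsub>S\<^esub> c \<oplus>\<^bsub>S\<^esub> (b \<ominus>\<^bsub>S\<^esub> d)"
          if "a \<in> carrier S" "b \<in> carrier S" "c \<in> carrier S" "d \<in> carrier S" for a b c d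
          using that by (simp add: S.M.minus_eq S.M.minus_add S.M.a_ac)
        show "\<Phi> h (\<Sum>g\<in>insert x F. frag_of ({defect (delta g)}, g)) \<ominus>\<^bsub>S\<^esub> (\<Oplus>\<^bsub>S\<^esub>g\<in>insert x F. delta g h \<odot>\<^bsub>S\<^esub> g)
          = ?a h \<odot>\<^bsub>S\<^esub> x \<oplus>\<^bsub>S\<^esub> (\<Phi> h ?c \<ominus>\<^bsub>S\<^esub> (\<Oplus>\<^bsub>S\<^esub>g\<in>F. delta g h \<odot>\<^bsub>S\<^esub> g))"
          unfolding 1 2 3
          by (rule id) (use sec_closed[OF def_delta h] x F \<Phi>_closed[OF h kc] del in
              \<open>auto intro!: S.smult_closed S.M.finsum_closed\<close>)
      qed
    qed
  qed
  from this[OF subset_refl] have "solution_span (\<lambda>h. \<Phi> h defect_frag \<ominus>\<^bsub>S\<^esub> (\<Oplus>\<^bsub>S\<^esub>g\<in>G. delta g h \<odot>\<^bsub>S\<^esub> g))"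
    by (simp only: defect_frag_def)
  then have "solution_span (\<lambda>h. \<Phi> h defect_frag \<ominus>\<^bsub>S\<^esub> h)"
    by (rule solution_span_cong) (intro ballI, subst finsum_delta, assumption, rule refl)
  \<comment> \<open>Both \<open>\<Phi>\<close> of \<open>defect_frag\<close> and its difference from
    the identity lie in the span, hence so does the identity.\<close>
  then show ?thesis
  proof (rule solution_span_diff[OF _ span_\<Phi>[OF flat_defect_frag_kernel[OF assms]]])
    have "x = y \<ominus>\<^bsub>S\<^esub> (y \<ominus>\<^bsub>S\<^esub> x)" if "x \<in> carrier S" "y \<in> carrier S" for x y
      using that by (simp add: S.M.minus_eq S.M.minus_add S.M.r_neg2)
    then show "\<forall>g\<in>G. g = \<Phi> g defect_frag \<ominus>\<^bsub>S\<^esub> (\<Phi> g defect_frag \<ominus>\<^bsub>S\<^esub> g)"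
      using \<Phi>_closed[OF _ N.kernel_keys[OF flat_defect_frag_kernel[OF assms]]] G_subset by blast
  qed
qed

end

text \<open>Solutions, with the relations collected in a set of triples instead of indexed families:
  relations that come from different sources can then be united.\<close>

definition scalar_respecting ::
    "('r, 'x) ring_scheme \<Rightarrow> ('r, 's, 'z) module_scheme \<Rightarrow> ('r \<times> 's \<times> 's) set \<Rightarrow> ('s \<Rightarrow> 'r) set" where
  "scalar_respecting R S Q = {a \<in> carrier S \<rightarrow> carrier R.
     \<forall>(r, s, s')\<in>Q. a (r \<odot>\<^bsub>S\<^esub> s \<oplus>\<^bsub>S\<^esub> s') = r \<otimes>\<^bsub>R\<^esub> a s \<oplus>\<^bsub>R\<^esub> a s'}"

text \<open>The span of the solutions contains the identity on the finite set \<open>G\<close>;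
  written out, this expands the elements of \<open>F\<close>.\<close>

lemma flat_equational_criterion:
  assumes "algebra R S" "flat_algebra R S"
    and Q: "finite Q" "Q \<subseteq> carrier R \<times> carrier S \<times> carrier S"
    and F: "finite F" "F \<subseteq> carrier S"
  obtains q :: nat and a s where "\<And>t. t < q \<Longrightarrow> a t \<in> scalar_respecting R S Q"
    "\<And>t. t < q \<Longrightarrow> s t \<in> carrier S"
    "\<And>x. x \<in> F \<Longrightarrow> x = (\<Oplus>\<^bsub>S\<^esub>t\<in>{..<q}. a t x \<odot>\<^bsub>S\<^esub> s t)"
proof -
  interpret S: algebra R S by fact
  obtain m and rel :: "nat \<Rightarrow> 'a \<times> 'c \<times> 'c" where rel: "Q = rel ` {..<m}"
    using Q(1) by (auto simp: finite_conv_nat_seg_image lessThan_def)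
  \<comment> \<open>Besides \<open>F\<close>, all elements that occur in a relation, including the
    combined one, have to be unknowns.\<close>
  define G where "G = F \<union> (\<Union>(r, s, s')\<in>Q. {s, s', r \<odot>\<^bsub>S\<^esub> s \<oplus>\<^bsub>S\<^esub> s'})"
  have relQ: "rel j \<in> Q" if "j < m" for j using that rel by auto
  interpret relations R S m "fst \<circ> rel" "fst \<circ> snd \<circ> rel" "snd \<circ> snd \<circ> rel" G
  proof (unfold_locales)
    show "finite G" unfolding G_def using Q(1) F(1) by auto
    show "G \<subseteq> carrier S" unfolding G_def using Q(2) F(2) by auto
    fix j assume "j < m"
    with relQ Q(2) show "(fst \<circ> rel) j \<in> carrier R" by fastforce
    from relQ[OF \<open>j < m\<close>] show "(fst \<circ> snd \<circ> rel) j \<in> G" "(snd \<circ> snd \<circ> rel) j \<in> G"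
      "(fst \<circ> rel) j \<odot>\<^bsub>S\<^esub> (fst \<circ> snd \<circ> rel) j \<oplus>\<^bsub>S\<^esub> (snd \<circ> snd \<circ> rel) j \<in> G"
      unfolding G_def by (auto simp: case_prod_unfold)
  qed
  have sol: "a \<in> scalar_respecting R S Q" if "solution a" for a
    using that solutionD[OF that] unfolding scalar_respecting_def rel
    by (auto simp: solution_def case_prod_unfold)
  from solution_span_finsum[OF flat_id_solution_span[OF assms(2)]] obtain q :: nat and a s where
    "\<forall>t<q. solution (a t) \<and> s t \<in> carrier S"
    "\<forall>g\<in>G. g = (\<Oplus>\<^bsub>S\<^esub>t\<in>{..<q}. a t g \<odot>\<^bsub>S\<^esub> s t)" by blast
  with sol that[of q a s] show thesis by (auto simp: G_def)
qed

section \<open>Homomorphisms from a finitely presented module into a flat base change\<close>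

context tensor
begin

text \<open>The action of \<open>R\<close> through \<open>M\<close> instead of \<open>S\<close>.
  Modulo \<open>K\<close> it agrees with \<open>scale\<close>, but it leaves the second components
  alone, so supports stay in \<open>carrier M \<times> F\<close>, and \<open>contract a\<close>
  commutes with it for every scalar function \<open>a\<close>.\<close>

definition scale_left :: "'r \<Rightarrow> ('m \<times> 's \<Rightarrow>\<^sub>0 int) \<Rightarrow> ('m \<times> 's \<Rightarrow>\<^sub>0 int)" where
  "scale_left r = frag_extend (\<lambda>(m, s). frag_of (r \<odot>\<^bsub>M\<^esub> m, s))"

lemma scale_left_simps [simp]:
  "scale_left r 0 = 0" "scale_left r (c - d) = scale_left r c - scale_left r d"
  "scale_left r (frag_of (m, s)) = frag_of (r \<odot>\<^bsub>M\<^esub> m, s)"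
  by (simp_all add: scale_left_def frag_extend_diff)

lemma scale_left_keys:
  "r \<in> carrier R \<Longrightarrow> keys c \<subseteq> carrier M \<times> F \<Longrightarrow> keys (scale_left r c) \<subseteq> carrier M \<times> F"
  unfolding scale_left_def by (rule order_trans[OF keys_frag_extend]) (auto simp: keys_frag_of)

lemma scale_left_eq_scale:
  assumes "r \<in> carrier R" "keys c \<subseteq> MS"
  shows "scale_left r c - scale (r \<odot>\<^bsub>S\<^esub> \<one>\<^bsub>S\<^esub>) c \<in> K"
  using assms(2)
proof (induction rule: frag_keys_induct)
  case (diff c d)
  then show ?case using kernel_diff[OF diff(3,4)] by (simp add: algebra_simps)
next
  case (gen x)
  then obtain m s where x: "x = (m, s)" "m \<in> carrier M" "s \<in> carrier S" by auto
  then have "(r \<odot>\<^bsub>S\<^esub> \<one>\<^bsub>S\<^esub>) \<otimes>\<^bsub>S\<^esub> s = r \<odot>\<^bsub>S\<^esub> s" using assms(1) by (simp add: S.smult_assoc2)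
  then show ?case using balanced[OF assms(1) x(2,3)] x by simp
qed (simp add: kernel_zero)

lemma diff_left:
  assumes "m \<in> carrier M" "m' \<in> carrier M" "s \<in> carrier S"
  shows "frag_of (m, s) - frag_of (m', s) - frag_of (m \<ominus>\<^bsub>M\<^esub> m', s) \<in> K"
proof -
  have "m \<ominus>\<^bsub>M\<^esub> m' \<oplus>\<^bsub>M\<^esub> m' = m" using assms by (simp add: M.minus_eq M.M.a_assoc M.M.l_neg)
  then have "frag_of (m, s) - frag_of (m \<ominus>\<^bsub>M\<^esub> m', s) - frag_of (m', s) \<in> K"
    using add_left[of "m \<ominus>\<^bsub>M\<^esub> m'" m' s] assms by (simp add: M.M.diff_closed)
  then show ?thesis by (simp add: algebra_simps)
qed

text \<open>Here \<open>a\<close> is any function, not a linear one; the contraction therefore lives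
  on representatives and need not descend to the tensor product.\<close>

definition contract :: "('s \<Rightarrow> 'r) \<Rightarrow> ('m \<times> 's \<Rightarrow>\<^sub>0 int) \<Rightarrow> 'm" where
  "contract a = frag_lift MS M (\<lambda>(m, s). a s \<odot>\<^bsub>M\<^esub> m)"

context
  fixes a :: "'s \<Rightarrow> 'r"
  assumes a: "a \<in> carrier S \<rightarrow> carrier R"
begin

lemma contract_pi: "(\<lambda>(m, s). a s \<odot>\<^bsub>M\<^esub> m) \<in> MS \<rightarrow> carrier M"
  using a by auto

lemmas contract_lift = frag_lift[OF M.M.abelian_group_axioms contract_pi, folded contract_def]

lemma contract_of: "m \<in> carrier M \<Longrightarrow> s \<in> carrier S \<Longrightarrow> contract a (frag_of (m, s)) = a s \<odot>\<^bsub>M\<^esub> m"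
  using contract_lift(1)[of "(m, s)"] by simp

lemmas contract_closed = contract_lift(2)
  and contract_add = contract_lift(3)
  and contract_zero = contract_lift(4)
  and contract_diff = contract_lift(5)

lemma contract_sum:
  assumes "finite J" "\<And>i. i \<in> J \<Longrightarrow> keys (c i) \<subseteq> MS"
  shows "contract a (\<Sum>i\<in>J. c i) = (\<Oplus>\<^bsub>M\<^esub>i\<in>J. contract a (c i))"
  using assms
proof (induction J rule: finite_induct)
  case empty
  then show ?case by (simp add: contract_zero)
next
  case (insert i J)
  have "keys (\<Sum>i\<in>J. c i) \<subseteq> MS"
    using insert.prems by (intro order_trans[OF keys_sum]) auto
  moreover have "(\<Oplus>\<^bsub>M\<^esub>i\<in>insert i J. contract a (c i)) = contract a (c i) \<oplus>\<^bsub>M\<^esub> (\<Oplus>\<^bsub>M\<^esub>i\<in>J. contract a (c i))"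
    by (rule M.M.finsum_insert) (use insert in \<open>auto intro!: contract_closed\<close>)
  ultimately show ?case using insert by (simp add: contract_add)
qed

lemma contract_scale_left:
  assumes "r \<in> carrier R" "keys c \<subseteq> MS"
  shows "contract a (scale_left r c) = r \<odot>\<^bsub>M\<^esub> contract a c"
  using assms(2)
proof (induction rule: frag_keys_induct)
  case zero
  then show ?case using assms(1) by (simp add: contract_zero)
next
  case (diff c d)
  then show ?case using assms(1) scale_left_keys[OF assms(1), of _ "carrier S"] contract_closed
    by (simp add: contract_diff M.minus_eq M.smult_r_distr M.smult_r_minus)
next
  case (gen x)
  then obtain m s where x: "x = (m, s)" "m \<in> carrier M" "s \<in> carrier S" by auto
  then have "a s \<in> carrier R" using a by auto
  then have "a s \<odot>\<^bsub>M\<^esub> (r \<odot>\<^bsub>M\<^esub> m) = r \<odot>\<^bsub>M\<^esub> (a s \<odot>\<^bsub>M\<^esub> m)"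
    using assms(1) x M.smult_assoc1[of r "a s" m] M.smult_assoc1[of "a s" r m] by (simp add: M.R.m_comm)
  then show ?case using x assms(1) by (simp add: contract_of)
qed

end

lemma scalar_respectingD:
  assumes "a \<in> scalar_respecting R S Q"
  shows "a \<in> carrier S \<rightarrow> carrier R"
    and "(r, s, s') \<in> Q \<Longrightarrow> a (r \<odot>\<^bsub>S\<^esub> s \<oplus>\<^bsub>S\<^esub> s') = r \<otimes>\<^bsub>R\<^esub> a s \<oplus>\<^bsub>R\<^esub> a s'"
  using assms by (auto simp: scalar_respecting_def)

lemma scalar_respecting_mono: "Q' \<subseteq> Q \<Longrightarrow> scalar_respecting R S Q \<subseteq> scalar_respecting R S Q'"
  by (auto simp: scalar_respecting_def)

text \<open>A kernel element involves finitely many relators, and each is contracted to zero once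
  \<open>a\<close> respects at most two relations. For a difference the two sets are united.\<close>

lemma contract_kernel:
  assumes "c \<in> K"
  shows "\<exists>Q. finite Q \<and> Q \<subseteq> carrier R \<times> carrier S \<times> carrier S \<and>
    (\<forall>a\<in>scalar_respecting R S Q. contract a c = \<zero>\<^bsub>M\<^esub>)"
  using assms
proof (induction rule: kernel_induct)
  case zero
  then show ?case using scalar_respectingD(1) contract_zero by (intro exI[of _ "{}"]) auto
next
  case (diff c d)
  then obtain Q Q' where Q: "finite Q" "Q \<subseteq> carrier R \<times> carrier S \<times> carrier S"
      "\<forall>a\<in>scalar_respecting R S Q. contract a c = \<zero>\<^bsub>M\<^esub>"
    and Q': "finite Q'" "Q' \<subseteq> carrier R \<times> carrier S \<times> carrier S"
      "\<forall>a\<in>scalar_respecting R S Q'. contract a d = \<zero>\<^bsub>M\<^esub>" by blast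
  have "contract a (c - d) = \<zero>\<^bsub>M\<^esub>" if "a \<in> scalar_respecting R S (Q \<union> Q')" for a
  proof -
    have "a \<in> scalar_respecting R S Q" "a \<in> scalar_respecting R S Q'"
      using that scalar_respecting_mono[of _ "Q \<union> Q'"] by blast+
    then show ?thesis
      using Q(3) Q'(3) contract_diff[OF scalar_respectingD(1)[OF that]] kernel_keys[OF diff(1)] kernel_keys[OF diff(2)]
      by (simp add: M.minus_eq)
  qed
  then show ?case using Q(1,2) Q'(1,2) by (intro exI[of _ "Q \<union> Q'"]) auto
next
  case (add_left m m' s)
  have "contract a (frag_of (m \<oplus>\<^bsub>M\<^esub> m', s) - frag_of (m, s) - frag_of (m', s)) = \<zero>\<^bsub>M\<^esub>"
    if "a \<in> scalar_respecting R S {}" for a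
  proof -
    note a = scalar_respectingD(1)[OF that]
    have "a s \<in> carrier R" using a add_left(3) by auto
    then show ?thesis using add_left
      by (simp add: M.M.add_minus_minus contract_diff[OF a] contract_of[OF a] keys_diff_subset keys_frag_of M.smult_r_distr)
  qed
  then show ?case by (intro exI[of _ "{}"]) simp
next
  case (add_right m s s')
  \<comment> \<open>The coefficient one expresses additivity on \<open>s\<close> and
    \<open>s'\<close>.\<close>
  let ?Q = "{(\<one>\<^bsub>R\<^esub>, s, s')}"
  have "contract a (frag_of (m, s \<oplus>\<^bsub>S\<^esub> s') - frag_of (m, s) - frag_of (m, s')) = \<zero>\<^bsub>M\<^esub>"
    if "a \<in> scalar_respecting R S ?Q" for a
  proof -
    note a = scalar_respectingD(1)[OF that]
    have s: "a s \<in> carrier R" "a s' \<in> carrier R" using a add_right by auto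
    have "a (s \<oplus>\<^bsub>S\<^esub> s') = a s \<oplus>\<^bsub>R\<^esub> a s'"
      using scalar_respectingD(2)[OF that, of "\<one>\<^bsub>R\<^esub>" s s'] add_right s by simp
    then show ?thesis using add_right s
      by (simp add: M.M.add_minus_minus contract_diff[OF a] contract_of[OF a] keys_diff_subset keys_frag_of M.smult_l_distr)
  qed
  then show ?case using add_right by (intro exI[of _ ?Q]) simp
next
  case (balanced r m s)
  \<comment> \<open>The first triple, ending in zero, expresses homogeneity once \<open>a\<close> is
    known to vanish at zero; the second forces that, as it says that the value of \<open>a\<close>
    at zero equals its double.\<close>
  let ?Q = "{(r, s, \<zero>\<^bsub>S\<^esub>), (\<one>\<^bsub>R\<^esub>, \<zero>\<^bsub>S\<^esub>, \<zero>\<^bsub>S\<^esub>)}"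
  have "contract a (frag_of (r \<odot>\<^bsub>M\<^esub> m, s) - frag_of (m, r \<odot>\<^bsub>S\<^esub> s)) = \<zero>\<^bsub>M\<^esub>"
    if "a \<in> scalar_respecting R S ?Q" for a
  proof -
    note a = scalar_respectingD(1)[OF that]
    have s: "a s \<in> carrier R" "a \<zero>\<^bsub>S\<^esub> \<in> carrier R" using a balanced by auto
    have "a \<zero>\<^bsub>S\<^esub> = a \<zero>\<^bsub>S\<^esub> \<oplus>\<^bsub>R\<^esub> a \<zero>\<^bsub>S\<^esub>"
      using scalar_respectingD(2)[OF that, of "\<one>\<^bsub>R\<^esub>" "\<zero>\<^bsub>S\<^esub>" "\<zero>\<^bsub>S\<^esub>"] s by simp
    then have "a \<zero>\<^bsub>S\<^esub> = \<zero>\<^bsub>R\<^esub>" using s(2) by (metis M.R.add.r_cancel_one')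
    then have "a (r \<odot>\<^bsub>S\<^esub> s) = r \<otimes>\<^bsub>R\<^esub> a s"
      using scalar_respectingD(2)[OF that, of r s "\<zero>\<^bsub>S\<^esub>"] balanced s by simp
    moreover have "a s \<odot>\<^bsub>M\<^esub> (r \<odot>\<^bsub>M\<^esub> m) = (r \<otimes>\<^bsub>R\<^esub> a s) \<odot>\<^bsub>M\<^esub> m"
      using balanced s M.smult_assoc1[of "a s" r m] by (simp add: M.R.m_comm)
    ultimately show ?thesis using balanced s
      by (simp add: contract_diff[OF a] contract_of[OF a] keys_frag_of M.minus_eq M.M.r_neg)
  qed
  then show ?case using balanced by (intro exI[of _ ?Q]) simp
qed

text \<open>For a single \<open>m\<close> and \<open>x\<close>, insert the expansion of
  \<open>x\<close> and move the scalars across: \<open>m\<close> tensor \<open>x\<close> is the sum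
  of the \<open>a t x \<odot> m\<close> tensor \<open>s t\<close>. Both sides are additive in
  \<open>c\<close> modulo \<open>K\<close>.\<close>

lemma contract_expansion:
  fixes q :: nat
  assumes a: "\<And>t. t < q \<Longrightarrow> a t \<in> carrier S \<rightarrow> carrier R" and s: "\<And>t. t < q \<Longrightarrow> s t \<in> carrier S"
    and F: "F \<subseteq> carrier S" "\<And>x. x \<in> F \<Longrightarrow> x = (\<Oplus>\<^bsub>S\<^esub>t\<in>{..<q}. a t x \<odot>\<^bsub>S\<^esub> s t)"
    and c: "keys c \<subseteq> carrier M \<times> F"
  shows "c - (\<Sum>t<q. frag_of (contract (a t) c, s t)) \<in> K"
  using c
proof (induction rule: frag_keys_induct)
  case zero
  have "(\<Sum>t<q. frag_of (contract (a t) 0, s t)) \<in> K"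
    using s by (intro kernel_sum) (simp add: contract_zero[OF a] zero_left)
  then show ?case using kernel_minus by simp
next
  case (diff c d)
  then have k: "keys c \<subseteq> MS" "keys d \<subseteq> MS" using F(1) by blast+
  have "(\<Sum>t<q. frag_of (contract (a t) c, s t) - frag_of (contract (a t) d, s t)) -
      (\<Sum>t<q. frag_of (contract (a t) (c - d), s t)) \<in> K"
    using s k contract_closed[OF a]
    by (intro kernel_diff_sum) (simp add: contract_diff[OF a] diff_left)
  from kernel_add[OF kernel_diff[OF diff(3,4)] this] show ?case
    by (simp add: algebra_simps sum_subtractf)
next
  case (gen x)
  then obtain m y where x: "x = (m, y)" "m \<in> carrier M" "y \<in> F" "y \<in> carrier S" using F(1) by auto
  have ay: "a t y \<in> carrier R" if "t < q" for t using a[OF that] x(4) by auto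
  have "frag_of (m, \<Oplus>\<^bsub>S\<^esub>t\<in>{..<q}. a t y \<odot>\<^bsub>S\<^esub> s t) - (\<Sum>t<q. frag_of (m, a t y \<odot>\<^bsub>S\<^esub> s t)) \<in> K"
    using s ay x(2) by (intro finsum_right) auto
  then have 1: "frag_of (m, y) - (\<Sum>t<q. frag_of (m, a t y \<odot>\<^bsub>S\<^esub> s t)) \<in> K"
    by (simp only: F(2)[OF x(3), symmetric])
  have 2: "(\<Sum>t<q. frag_of (m, a t y \<odot>\<^bsub>S\<^esub> s t)) - (\<Sum>t<q. frag_of (contract (a t) (frag_of (m, y)), s t)) \<in> K"
  proof (intro kernel_diff_sum)
    fix t assume "t \<in> {..<q}"
    then show "frag_of (m, a t y \<odot>\<^bsub>S\<^esub> s t) - frag_of (contract (a t) (frag_of (m, y)), s t) \<in> K"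
      using s ay x(2,4) kernel_diff_commute[OF balanced] by (simp add: contract_of[OF a])
  qed
  show ?case unfolding x(1) by (rule kernel_diff_trans[OF 1 2])
qed

text \<open>The map \<open>\<psi>\<close> is only assumed \<open>R\<close>-linear, with
  \<open>R\<close> acting through \<open>r \<odot> \<one>\<close>, because it will be an
  \<open>S\<close>-linear map restricted to the tensors \<open>b \<otimes> s\<close> with
  \<open>s\<close> fixed. The maps \<open>f t\<close> come from contracting representatives of its
  values.\<close>

lemma fp_hom_expansion:
  assumes B: "module R B" and fp: "finitely_presented R B" and flat: "flat_algebra R S"
    and \<psi>_closed: "\<And>b. b \<in> carrier B \<Longrightarrow> \<psi> b \<in> carrier T"
    and \<psi>_add: "\<And>b b'. b \<in> carrier B \<Longrightarrow> b' \<in> carrier B \<Longrightarrow> \<psi> (b \<oplus>\<^bsub>B\<^esub> b') = \<psi> b \<oplus>\<^bsub>T\<^esub> \<psi> b'"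
    and \<psi>_smult: "\<And>r b. r \<in> carrier R \<Longrightarrow> b \<in> carrier B \<Longrightarrow>
      \<psi> (r \<odot>\<^bsub>B\<^esub> b) = (r \<odot>\<^bsub>S\<^esub> \<one>\<^bsub>S\<^esub>) \<odot>\<^bsub>T\<^esub> \<psi> b"
  obtains q :: nat and f s where "\<And>t. t < q \<Longrightarrow> f t \<in> module_hom R B M" "\<And>t. t < q \<Longrightarrow> s t \<in> carrier S"
    "\<And>b. b \<in> carrier B \<Longrightarrow> \<psi> b = cls (\<Sum>t<q. frag_of (f t b, s t))"
proof -
  interpret B: module R B by fact
  obtain n p K0 where p: "p \<in> module_hom R (free_module R n) B"
    and surj: "p ` carrier (free_module R n) = carrier B"
    and K0: "finite K0" "K0 \<subseteq> carrier (free_module R n)"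
    and ker: "{v \<in> carrier (free_module R n). p v = \<zero>\<^bsub>B\<^esub>} = submodule_generated R (free_module R n) K0"
    using fp unfolding finitely_presented_def by blast
  let ?L = "free_module R n"
  have L_module: "module R ?L" by (rule module_free_module) (rule M.R.is_cring)
  interpret L: module R ?L by (rule L_module)
  note pD = module_homD[OF p]
  have L_carrier: "v \<in> carrier ?L \<longleftrightarrow> v \<in> {..<n} \<rightarrow>\<^sub>E carrier R" for v by (simp add: free_module_def)
  have L_i: "v i \<in> carrier R" if "v \<in> carrier ?L" "i < n" for v i using that by (auto simp: L_carrier)
  \<comment> \<open>The unit vectors; for \<open>k\<close> at least \<open>n\<close> this is the
    zero vector, so that the choice of \<open>c k\<close> below is possible for all
    \<open>k\<close>.\<close>
  define e where "e k = (\<lambda>j\<in>{..<n}. if j = k then \<one>\<^bsub>R\<^esub> else \<zero>\<^bsub>R\<^esub>)" for k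
  have e: "e k \<in> carrier ?L" for k by (auto simp: L_carrier e_def)
  have "\<exists>c. keys c \<subseteq> MS \<and> \<psi> (p (e k)) = cls c" for k
    using \<psi>_closed[OF pD(1)[OF e[of k]]] by (auto simp: carrier_T)
  then obtain c where c: "\<And>k. keys (c k) \<subseteq> MS" "\<And>k. \<psi> (p (e k)) = cls (c k)" by metis
  \<comment> \<open>A representative of \<open>\<psi> (p v)\<close>, built with
    \<open>scale_left\<close> so that for every \<open>v\<close> its second components come from the
    finite set \<open>F\<close> below.\<close>
  define \<Gamma> where "\<Gamma> v = (\<Sum>i<n. scale_left (v i) (c i))" for v
  have \<psi>_zero: "\<psi> \<zero>\<^bsub>B\<^esub> = cls 0"
    using \<psi>_smult[of "\<zero>\<^bsub>R\<^esub>" "\<zero>\<^bsub>B\<^esub>"] \<psi>_closed[of "\<zero>\<^bsub>B\<^esub>"] by (simp add: zero_T)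
  have \<Gamma>: "\<psi> (p v) = cls (\<Gamma> v)" if v: "v \<in> carrier ?L" for v
  proof -
    \<comment> \<open>Truncations of \<open>v\<close>, which add one coordinate at a time and end
      with \<open>v\<close> itself.\<close>
    define u where "u k = (\<lambda>j\<in>{..<n}. if j < k then v j else \<zero>\<^bsub>R\<^esub>)" for k
    have u: "u k \<in> carrier ?L" for k using L_i[OF v] by (auto simp: u_def L_carrier)
    have "k \<le> n \<Longrightarrow> \<psi> (p (u k)) = cls (\<Sum>i<k. scale_left (v i) (c i))" for k
    proof (induction k)
      case 0
      have "u 0 = \<zero>\<^bsub>?L\<^esub>" by (simp add: u_def free_module_def)
      then show ?case by (simp add: module_hom_zero[OF L_module B p] \<psi>_zero)
    next
      case (Suc k)
      then have vk: "v k \<in> carrier R" using L_i[OF v] by simp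
      have "u (Suc k) = u k \<oplus>\<^bsub>?L\<^esub> v k \<odot>\<^bsub>?L\<^esub> e k"
        using L_i[OF v] vk by (auto simp: u_def e_def free_module_def fun_eq_iff less_Suc_eq)
      then have "\<psi> (p (u (Suc k))) = cls (\<Sum>i<k. scale_left (v i) (c i)) \<oplus>\<^bsub>T\<^esub> (v k \<odot>\<^bsub>S\<^esub> \<one>\<^bsub>S\<^esub>) \<odot>\<^bsub>T\<^esub> cls (c k)"
        using Suc u e vk by (simp add: pD \<psi>_add \<psi>_smult c(2))
      also have "(v k \<odot>\<^bsub>S\<^esub> \<one>\<^bsub>S\<^esub>) \<odot>\<^bsub>T\<^esub> cls (c k) = cls (scale_left (v k) (c k))"
        using vk kernel_diff_commute[OF scale_left_eq_scale[OF vk c(1), of k]] by (simp add: smult_T cls_eq_iff)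
      finally show ?case by (simp add: add_T)
    qed
    moreover have "u n = v" using v by (auto simp: u_def L_carrier fun_eq_iff PiE_def extensional_def)
    ultimately show ?thesis unfolding \<Gamma>_def by (metis order_refl)
  qed
  define F where "F = snd ` (\<Union>i<n. keys (c i))"
  have F: "finite F" "F \<subseteq> carrier S" using c(1) unfolding F_def by fastforce+
  have cF: "keys (c i) \<subseteq> carrier M \<times> F" if "i < n" for i
    using that c(1)[of i] unfolding F_def by force
  have \<Gamma>_keys: "keys (\<Gamma> v) \<subseteq> carrier M \<times> F" if "v \<in> carrier ?L" for v
  proof -
    have "keys (scale_left (v i) (c i)) \<subseteq> carrier M \<times> F" if "i < n" for i
      using scale_left_keys[OF L_i[OF \<open>v \<in> carrier ?L\<close> that] cF[OF that]] .
    then show ?thesis unfolding \<Gamma>_def by (intro order_trans[OF keys_sum]) blast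
  qed
  \<comment> \<open>A relation \<open>v\<close> of \<open>B\<close> makes \<open>\<Gamma> v\<close>
    represent zero, so its contraction vanishes as soon as \<open>a\<close> respects finitely many
    relations in \<open>S\<close>.\<close>
  have "\<exists>Q. finite Q \<and> Q \<subseteq> carrier R \<times> carrier S \<times> carrier S \<and>
    (\<forall>a\<in>scalar_respecting R S Q. contract a (\<Gamma> v) = \<zero>\<^bsub>M\<^esub>)" if "v \<in> K0" for v
  proof (rule contract_kernel)
    have "v \<in> carrier ?L" "p v = \<zero>\<^bsub>B\<^esub>"
      using that submodule_generated_incl[of K0 R ?L] ker by blast+
    then have "cls (\<Gamma> v) = cls 0" using \<Gamma> \<psi>_zero by metis
    then show "\<Gamma> v \<in> K" by (simp add: cls_eq_iff)
  qed
  then obtain Q where Q: "\<And>v. v \<in> K0 \<Longrightarrow> finite (Q v)"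
      "\<And>v. v \<in> K0 \<Longrightarrow> Q v \<subseteq> carrier R \<times> carrier S \<times> carrier S"
      "\<And>v a. v \<in> K0 \<Longrightarrow> a \<in> scalar_respecting R S (Q v) \<Longrightarrow> contract a (\<Gamma> v) = \<zero>\<^bsub>M\<^esub>"
    by metis
  \<comment> \<open>As \<open>K0\<close> is finite, one system of functions \<open>a t\<close> works
    for all its elements; it also expands all elements of \<open>F\<close>.\<close>
  obtain q :: nat and a s where a: "\<And>t. t < q \<Longrightarrow> a t \<in> scalar_respecting R S (\<Union>v\<in>K0. Q v)"
    and s: "\<And>t. t < q \<Longrightarrow> s t \<in> carrier S"
    and x: "\<And>x. x \<in> F \<Longrightarrow> x = (\<Oplus>\<^bsub>S\<^esub>t\<in>{..<q}. a t x \<odot>\<^bsub>S\<^esub> s t)"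
  proof (rule flat_equational_criterion[OF S_algebra flat])
    show "finite (\<Union>v\<in>K0. Q v)" "(\<Union>v\<in>K0. Q v) \<subseteq> carrier R \<times> carrier S \<times> carrier S"
      using K0(1) Q(1,2) by blast+
  qed (use F in auto)
  \<comment> \<open>Contracting \<open>\<Gamma>\<close> is linear on the free module and vanishes on
    \<open>K0\<close>, hence on the kernel of \<open>p\<close>, and so factors through
    \<open>B\<close>.\<close>
  have "\<exists>f. f \<in> module_hom R B M \<and> (\<forall>v\<in>carrier ?L. f (p v) = contract (a t) (\<Gamma> v))" if t: "t < q" for t
  proof -
    note at = scalar_respectingD(1)[OF a[OF t]]
    have cc: "contract (a t) (c i) \<in> carrier M" for i by (rule contract_closed[OF at c(1)])
    \<comment> \<open>After contraction the scalars come out, which gives a formula visibly linear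
      in \<open>v\<close>; \<open>\<Gamma>\<close> itself need not be additive.\<close>
    have eq: "contract (a t) (\<Gamma> v) = (\<Oplus>\<^bsub>M\<^esub>i\<in>{..<n}. v i \<odot>\<^bsub>M\<^esub> contract (a t) (c i))" if v: "v \<in> carrier ?L" for v
    proof -
      have "contract (a t) (\<Gamma> v) = (\<Oplus>\<^bsub>M\<^esub>i\<in>{..<n}. contract (a t) (scale_left (v i) (c i)))"
        unfolding \<Gamma>_def using L_i[OF v] c(1) scale_left_keys[of _ _ "carrier S"]
        by (intro contract_sum[OF at]) auto
      also have "\<dots> = (\<Oplus>\<^bsub>M\<^esub>i\<in>{..<n}. v i \<odot>\<^bsub>M\<^esub> contract (a t) (c i))"
        using L_i[OF v] c(1) cc by (intro M.M.finsum_cong') (auto simp: contract_scale_left[OF at])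
      finally show ?thesis .
    qed
    have hom: "(\<lambda>v. contract (a t) (\<Gamma> v)) \<in> module_hom R ?L M"
      unfolding module_hom_def mem_Collect_eq
    proof (intro conjI ballI funcsetI)
      fix v assume v: "v \<in> carrier ?L"
      have vi: "(\<lambda>i. v i \<odot>\<^bsub>M\<^esub> contract (a t) (c i)) \<in> {..<n} \<rightarrow> carrier M" using L_i[OF v] cc by auto
      show "contract (a t) (\<Gamma> v) \<in> carrier M" unfolding eq[OF v] by (rule M.M.finsum_closed[OF vi])
      show "contract (a t) (\<Gamma> (r \<odot>\<^bsub>?L\<^esub> v)) = r \<odot>\<^bsub>M\<^esub> contract (a t) (\<Gamma> v)" if r: "r \<in> carrier R" for r
      proof -
        have "contract (a t) (\<Gamma> (r \<odot>\<^bsub>?L\<^esub> v)) = (\<Oplus>\<^bsub>M\<^esub>i\<in>{..<n}. r \<odot>\<^bsub>M\<^esub> (v i \<odot>\<^bsub>M\<^esub> contract (a t) (c i)))"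
          unfolding eq[OF L.smult_closed[OF r v]]
          by (rule M.M.finsum_cong') (use L_i[OF v] cc r in \<open>auto simp: free_module_def M.smult_assoc1\<close>)
        then show ?thesis unfolding eq[OF v] using M.finsum_smult_ldistr[OF _ r vi] by simp
      qed
      fix w assume w: "w \<in> carrier ?L"
      have wi: "(\<lambda>i. w i \<odot>\<^bsub>M\<^esub> contract (a t) (c i)) \<in> {..<n} \<rightarrow> carrier M" using L_i[OF w] cc by auto
      have "contract (a t) (\<Gamma> (v \<oplus>\<^bsub>?L\<^esub> w)) =
          (\<Oplus>\<^bsub>M\<^esub>i\<in>{..<n}. v i \<odot>\<^bsub>M\<^esub> contract (a t) (c i) \<oplus>\<^bsub>M\<^esub> w i \<odot>\<^bsub>M\<^esub> contract (a t) (c i))"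
        unfolding eq[OF L.M.a_closed[OF v w]]
        by (rule M.M.finsum_cong') (use L_i[OF v] L_i[OF w] cc in \<open>auto simp: free_module_def M.smult_l_distr\<close>)
      then show "contract (a t) (\<Gamma> (v \<oplus>\<^bsub>?L\<^esub> w)) = contract (a t) (\<Gamma> v) \<oplus>\<^bsub>M\<^esub> contract (a t) (\<Gamma> w)"
        unfolding eq[OF v] eq[OF w] using M.M.finsum_addf[OF vi wi] by simp
    qed
    have "K0 \<subseteq> {v \<in> carrier ?L. contract (a t) (\<Gamma> v) = \<zero>\<^bsub>M\<^esub>}"
    proof
      fix v assume v: "v \<in> K0"
      then have "a t \<in> scalar_respecting R S (Q v)"
        using a[OF t] scalar_respecting_mono[of "Q v" "\<Union>v\<in>K0. Q v"] by blast
      then show "v \<in> {v \<in> carrier ?L. contract (a t) (\<Gamma> v) = \<zero>\<^bsub>M\<^esub>}" using Q(3) v K0(2) by blast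
    qed
    then have "{v \<in> carrier ?L. p v = \<zero>\<^bsub>B\<^esub>} \<subseteq> {v \<in> carrier ?L. contract (a t) (\<Gamma> v) = \<zero>\<^bsub>M\<^esub>}"
      unfolding ker by (rule submodule_generated_minimal) (rule kernel_submodule[OF L_module M_module hom])
    then obtain f where "f \<in> module_hom R B M" "\<And>v. v \<in> carrier ?L \<Longrightarrow> f (p v) = contract (a t) (\<Gamma> v)"
      using module_hom_factor[OF L_module B M_module p surj hom] by blast
    then show ?thesis by blast
  qed
  then obtain f where f: "\<And>t. t < q \<Longrightarrow> f t \<in> module_hom R B M"
      "\<And>t v. t < q \<Longrightarrow> v \<in> carrier ?L \<Longrightarrow> f t (p v) = contract (a t) (\<Gamma> v)"
    by metis
  show thesis
  proof (rule that[of q f s])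
    fix b assume "b \<in> carrier B"
    then obtain v where v: "v \<in> carrier ?L" "b = p v" using surj by blast
    \<comment> \<open>The functions \<open>a t\<close> do not depend on \<open>v\<close>, and all
      \<open>\<Gamma> v\<close> have second components in \<open>F\<close>, so one expansion serves
      all \<open>b\<close>.\<close>
    have "\<Gamma> v - (\<Sum>t<q. frag_of (contract (a t) (\<Gamma> v), s t)) \<in> K"
      by (rule contract_expansion[OF scalar_respectingD(1)[OF a] s F(2) x \<Gamma>_keys[OF v(1)]])
    then show "\<psi> b = cls (\<Sum>t<q. frag_of (f t b, s t))"
      using v \<Gamma>[OF v(1)] f(2) by (simp add: cls_eq_iff)
  qed (rule f(1) s; assumption)+
qed

end

section \<open>Traces and base change\<close>

theorem theorem8p12:
  fixes R :: "'r ring" and S :: "('r, 's) module"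
    and B :: "('r, 'b) module" and M :: "('r, 'm) module"
    and X :: "'b set"
  assumes "cring R"
    and "module R B"
    and "X \<subseteq> carrier B"
    and "algebra R S"
    and "module R M"
  shows
    "let X' = {pure_tensor R B S x s |x s. x \<in> X \<and> s \<in> carrier S};
         T = trace_submodule R X B M;
         I = base_change_map R M S (\<lambda>t. t) ` carrier (base_change R (M\<lparr>carrier := T\<rparr>) S);
         T' = trace_submodule S X' (base_change R B S) (base_change R M S)
     in submodule I S (base_change R M S) \<and>
        submodule T' S (base_change R M S) \<and>
        I \<subseteq> T' \<and>
        (finitely_presented R B \<and> flat_algebra R S \<longrightarrow> I = T')"
proof -
  interpret M: tensor R M S using assms(5,4) by (rule tensor.intro)
  interpret B: tensor R B S using assms(2,4) by (rule tensor.intro)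
  define X' where "X' = {pure_tensor R B S x s |x s. x \<in> X \<and> s \<in> carrier S}"
  define T where "T = trace_submodule R X B M"
  define T' where "T' = trace_submodule S X' (base_change R B S) (base_change R M S)"
  \<comment> \<open>By \<open>base_change_map_inclusion_image\<close> this is the image in the
    statement, described by representatives.\<close>
  let ?I = "M.cls ` {c. keys c \<subseteq> T \<times> carrier S}"
  have T: "submodule T R M"
    unfolding T_def using assms(5,3) by (rule trace_submodule_submodule)
  have I: "submodule ?I S M.T" by (rule M.submodule_cls_image[OF T])
  have X': "X' \<subseteq> carrier B.T"
    using assms(3) by (auto simp: X'_def pure_tensor_def intro!: B.cls_closed)
  have T': "submodule T' S M.T"
    unfolding T'_def using M.module_T X' by (rule trace_submodule_submodule)
  note T'_rules = M.T.submoduleE[OF T']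
  have TM: "T \<subseteq> carrier M" by (rule M.M.submoduleE(1)[OF T])

  \<comment> \<open>As \<open>T\<close> is generated by values \<open>f x\<close>, it suffices to
    test these against a submodule: \<open>H\<close> collects the \<open>m\<close> all of whose
    tensors lie in \<open>T'\<close>.\<close>
  define H where "H = {m \<in> carrier M. \<forall>s\<in>carrier S. M.cls (frag_of (m, s)) \<in> T'}"
  have H: "submodule H R M"
  proof (rule M.M.submoduleI)
    have zero: "M.cls 0 \<in> T'"
      using subgroup.one_closed[OF submodule.axioms(1)[OF T']] by (simp add: M.zero_T)
    have "M.cls (frag_of (\<zero>\<^bsub>M\<^esub>, s)) = M.cls 0" if "s \<in> carrier S" for s
      using M.zero_left[OF that] by (simp add: M.cls_eq_iff)
    with zero show "\<zero>\<^bsub>M\<^esub> \<in> H" by (simp add: H_def)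
    fix x assume x: "x \<in> H"
    have smult: "r \<odot>\<^bsub>M\<^esub> x \<in> H" if "r \<in> carrier R" for r
    proof -
      \<comment> \<open>Scalars pass to the second factor, where \<open>H\<close> allows any element
        of \<open>S\<close>.\<close>
      have "M.cls (frag_of (r \<odot>\<^bsub>M\<^esub> x, s)) = M.cls (frag_of (x, r \<odot>\<^bsub>S\<^esub> s))" if "s \<in> carrier S" for s
        using M.balanced[OF \<open>r \<in> carrier R\<close> _ that, of x] x by (simp add: M.cls_eq_iff H_def)
      with x that show ?thesis by (simp add: H_def)
    qed
    then show "r \<odot>\<^bsub>M\<^esub> x \<in> H" if "r \<in> carrier R" for r using that .
    have "\<ominus>\<^bsub>M\<^esub> x = (\<ominus>\<^bsub>R\<^esub> \<one>\<^bsub>R\<^esub>) \<odot>\<^bsub>M\<^esub> x"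
      using x by (simp add: H_def M.M.smult_l_minus)
    then show "\<ominus>\<^bsub>M\<^esub> x \<in> H" using smult by simp
    fix y assume y: "y \<in> H"
    have "M.cls (frag_of (x \<oplus>\<^bsub>M\<^esub> y, s)) = M.cls (frag_of (x, s)) \<oplus>\<^bsub>M.T\<^esub> M.cls (frag_of (y, s))"
      if "s \<in> carrier S" for s
      using M.add_left[of x y s] that x y by (simp add: M.add_T M.cls_eq_iff H_def algebra_simps)
    with x y T'_rules(5) show "x \<oplus>\<^bsub>M\<^esub> y \<in> H" by (simp add: H_def)
  qed (auto simp: H_def)
  have "T \<subseteq> H"
    unfolding T_def trace_submodule_def
  proof (rule submodule_generated_minimal[OF _ H], clarify)
    fix f x assume f: "f \<in> module_hom R B M" and x: "x \<in> X"
    have "M.cls (frag_of (f x, s)) \<in> T'" if s: "s \<in> carrier S" for s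
    proof -
      \<comment> \<open>The map induced by \<open>f\<close> is one of those that define
        \<open>T'\<close>, and it sends \<open>x\<close> tensor \<open>s\<close> to
        \<open>f x\<close> tensor \<open>s\<close>.\<close>
      have "base_change_map R M S f (pure_tensor R B S x s) \<in> T'"
        unfolding T'_def
        by (rule trace_submodule_mem[OF B.base_change_map_hom[OF assms(5) f]]) (use x s in \<open>auto simp: X'_def\<close>)
      then show ?thesis by (simp add: pure_tensor_def B.base_change_map_cls[OF assms(5) f])
    qed
    then show "f x \<in> H" using module_homD(1)[OF f] x assms(3) by (auto simp: H_def)
  qed
  have "M.cls c \<in> T'" if "keys c \<subseteq> T \<times> carrier S" for c
    using that
  proof (induction rule: frag_keys_induct)
    case zero
    then show ?case
      using subgroup.one_closed[OF submodule.axioms(1)[OF T']] by (simp add: M.zero_T)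
  next
    case (diff c d)
    have "keys d \<subseteq> M.MS" using diff(2) TM by blast
    then have "M.cls (- d) \<in> T'" using T'_rules(3)[OF diff(4)] by (simp add: M.minus_T)
    from T'_rules(5)[OF diff(3) this] show ?case by (simp add: M.add_T)
  next
    case (gen x)
    then show ?case using \<open>T \<subseteq> H\<close> by (auto simp: H_def)
  qed
  then have incl: "?I \<subseteq> T'" by blast
  \<comment> \<open>As \<open>?I\<close> is a submodule, only the generators \<open>\<phi> y\<close>
    matter, where \<open>y\<close> is \<open>x\<close> tensor \<open>s\<close>. With
    \<open>s\<close> fixed, \<open>\<phi>\<close> is expanded as an \<open>R\<close>-linear map of
    the first factor.\<close>
  have "T' \<subseteq> ?I" if fp: "finitely_presented R B" and flat: "flat_algebra R S"
    unfolding T'_def trace_submodule_def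
  proof (rule submodule_generated_minimal[OF _ I], clarify)
    fix \<phi> y assume \<phi>: "\<phi> \<in> module_hom S B.T M.T" and "y \<in> X'"
    then obtain x s where x: "x \<in> X" "x \<in> carrier B" and s: "s \<in> carrier S" and y: "y = B.cls (frag_of (x, s))"
      using assms(3) by (auto simp: X'_def pure_tensor_def)
    note \<phi>D = module_homD[OF \<phi>]
    have closed: "B.cls (frag_of (b, s)) \<in> carrier B.T" if "b \<in> carrier B" for b
      using that s by (intro B.cls_closed) simp
    obtain q :: nat and f z where f: "\<And>t. t < q \<Longrightarrow> f t \<in> module_hom R B M"
      and z: "\<And>t. t < q \<Longrightarrow> z t \<in> carrier S"
      and exp: "\<And>b. b \<in> carrier B \<Longrightarrow> \<phi> (B.cls (frag_of (b, s))) = M.cls (\<Sum>t<q. frag_of (f t b, z t))"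
    proof (rule M.fp_hom_expansion[OF assms(2) fp flat, of "\<lambda>b. \<phi> (B.cls (frag_of (b, s)))"])
      show "\<phi> (B.cls (frag_of (b, s))) \<in> carrier M.T" if "b \<in> carrier B" for b
        using \<phi>D(1) closed that by simp
      show "\<phi> (B.cls (frag_of (b \<oplus>\<^bsub>B\<^esub> b', s))) =
          \<phi> (B.cls (frag_of (b, s))) \<oplus>\<^bsub>M.T\<^esub> \<phi> (B.cls (frag_of (b', s)))"
        if "b \<in> carrier B" "b' \<in> carrier B" for b b'
      proof -
        have "B.cls (frag_of (b \<oplus>\<^bsub>B\<^esub> b', s)) = B.cls (frag_of (b, s)) \<oplus>\<^bsub>B.T\<^esub> B.cls (frag_of (b', s))"
          using B.add_left[OF that s] by (simp add: B.add_T B.cls_eq_iff algebra_simps)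
        then show ?thesis using \<phi>D(2) closed that by simp
      qed
      show "\<phi> (B.cls (frag_of (r \<odot>\<^bsub>B\<^esub> b, s))) = (r \<odot>\<^bsub>S\<^esub> \<one>\<^bsub>S\<^esub>) \<odot>\<^bsub>M.T\<^esub> \<phi> (B.cls (frag_of (b, s)))"
        if "r \<in> carrier R" "b \<in> carrier B" for r b
      proof -
        \<comment> \<open>\<open>R\<close> acts on the base change through its image in
          \<open>S\<close>, so linearity over \<open>S\<close> yields the condition on scalars from
          \<open>R\<close>.\<close>
        have "B.cls (frag_of (r \<odot>\<^bsub>B\<^esub> b, s)) = (r \<odot>\<^bsub>S\<^esub> \<one>\<^bsub>S\<^esub>) \<odot>\<^bsub>B.T\<^esub> B.cls (frag_of (b, s))"
          using B.scale_left_eq_scale[of r "frag_of (b, s)"] that s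
          by (simp add: B.smult_T B.cls_eq_iff)
        then show ?thesis using \<phi>D(3) closed that by simp
      qed
    qed blast
    \<comment> \<open>Each \<open>f t\<close> is a linear map from \<open>B\<close> to
      \<open>M\<close> and \<open>x\<close> is in \<open>X\<close>, so the expansion is supported on
      \<open>T\<close>.\<close>
    have "f t x \<in> T" if "t < q" for t
      unfolding T_def using f[OF that] x(1) by (rule trace_submodule_mem)
    then have "keys (\<Sum>t<q. frag_of (f t x, z t)) \<subseteq> T \<times> carrier S"
      using z by (intro order_trans[OF keys_sum]) (auto simp: keys_frag_of)
    then show "\<phi> y \<in> ?I" unfolding y exp[OF x(2)] by blast
  qed
  with incl I T' show ?thesis
    unfolding Let_def X'_def[symmetric] T_def[symmetric] T'_def[symmetric]
      M.base_change_map_inclusion_image[OF T] by blast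
qed

end
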